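(* Let $X$ be a real or complex Banach space. Let $I$ be a non-empty set, possibly uncountable, and let $\{C_{i}\}_{i\in I}$ be a collection of closed, not necessarily proper, cones in $X$, such that every $x\in X$ can be written as an absolutely convergent series $x=\sum_{i\in I}c_{i}$, where $c_{i}\in C_{i}$ for all $i\in I$. Let $\Omega$ be a topological space. Then there exists a constant $K>0$ with the property that, for each $X$-valued continuous function $f\in C(\Omega,X)$ on $\Omega$, there exist $f_{i}\in C(\Omega,C_{i})$ $(i\in I)$ such that: (1) for every $\omega\in\Omega$, $f(\omega)=\sum_{i\in I}f_{i}(\omega)$ and $\sum_{i\in I}\|f_{i}(\omega)\|\leq K\|f(\omega)\|$; (2) $\|f_{i}\|_{\infty}\leq K\|f\|_{\infty}$ for all $i\in I$, where the right hand side, or both the left hand side and the right hand side, may be infinite; (3) the support of each $f_{i}$ is contained in that of $f$; (4) if $f$ vanishes at infinity, then so does each $f_{i}$; (5) if $\omega_{1},\omega_{2}\in\Omega$ and $\lambda_{1},\lambda_{2}\geq0$ are such that $\lambda_{1}f(\omega_{1})=\lambda_{2}f(\omega_{2})$, then $\lambda_{1}f_{i}(\omega_{1})=\lambda_{2}f_{i}(\omega_{2})$ for all $i\in I$. In particular, if $I$ is finite, so that $X=\sum_{i\in I}C_{i}$, then the following vector spaces can be written as the sum of cones naturally associated with the $C_{i}$, where the cones are closed in the last three normed spaces: (1) $C(\Omega,X)=\sum_{i\in I}C(\Omega,C_{i})$; (2) $C_{b}(\Omega,X)=\sum_{i\in I}C_{b}(\Omega,C_{i})$; (3) $C_{0}(\Omega,X)=\sum_{i\in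 I}C_{0}(\Omega,C_{i})$; (4) $C_{c}(\Omega,X)=\sum_{i\in I}C_{c}(\Omega,C_{i})$.
   Context: A subset $C$ of a real or complex vector space is a cone if $C+C\subseteq C$ and $\lambda C\subseteq C$ for all real $\lambda\geq 0$; it is proper if $C\cap(-C)=\{0\}$ (not assumed here). A series $\sum_{i\in I}c_i$ is absolutely convergent if $\sum_{i\in I}\|c_i\|<\infty$. For a topological space $\Omega$ (no further assumptions), $C(\Omega,X)$, $C_b(\Omega,X)$, $C_0(\Omega,X)$, $C_c(\Omega,X)$ denote the continuous $X$-valued functions on $\Omega$ that are, respectively, arbitrary, bounded, vanishing at infinity (i.e. $\{\omega:\|f(\omega)\|\geq\varepsilon\}$ is compact for every $\varepsilon>0$), and compactly supported (the support being the closure of $\{\omega:f(\omega)\neq0\}$). The last three are normed by $\|f\|_\infty=\sup_{\omega\in\Omega}\|f(\omega)\|$. $C(\Omega,C_i)$, $C_b(\Omega,C_i)$, $C_0(\Omega,C_i)$, $C_c(\Omega,C_i)$ denote the subsets of those functions taking values in $C_i$. *)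

theory Defs
  imports "HOL-Analysis.Analysis"
begin

text \<open>
  The scalars of a cone are real, so a complex Banach space enters only through its underlying
  real Banach space. The sum of sets is the one of \<^theory>\<open>HOL-Library.Set_Algebras\<close>.
\<close>

definition additive_cone :: "'x::real_vector set \<Rightarrow> bool" where
  "additive_cone C \<longleftrightarrow> C + C \<subseteq> C \<and> (\<forall>r\<ge>0. (\<lambda>x. r *\<^sub>R x) ` C \<subseteq> C)"

text \<open>
  The topological space \<open>\<Omega>\<close> is an abstract topology, so it may be empty and need not fill its type.
  Functions on it are extensional (equal to \<^const>\<open>undefined\<close> off \<^term>\<open>topspace \<Omega>\<close>), in line
  with \<^const>\<open>cfunspace\<close>; the pointwise operations below therefore restrict to
  \<^term>\<open>topspace \<Omega>\<close>. The full spaces are obtained for \<^term>\<open>S = UNIV\<close>.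
\<close>

definition cont_funs :: "'a topology \<Rightarrow> 'x::real_normed_vector set \<Rightarrow> ('a \<Rightarrow> 'x) set" where
  "cont_funs \<Omega> S = {f \<in> extensional (topspace \<Omega>). continuous_map \<Omega> (top_of_set S) f}"

definition vanishes_at_infinity :: "'a topology \<Rightarrow> ('a \<Rightarrow> 'x::real_normed_vector) \<Rightarrow> bool" where
  "vanishes_at_infinity \<Omega> f \<longleftrightarrow> (\<forall>\<epsilon>>0. compactin \<Omega> {\<omega> \<in> topspace \<Omega>. norm (f \<omega>) \<ge> \<epsilon>})"

definition fun_support :: "'a topology \<Rightarrow> ('a \<Rightarrow> 'x::real_normed_vector) \<Rightarrow> 'a set" where
  "fun_support \<Omega> f = \<Omega> closure_of {\<omega> \<in> topspace \<Omega>. f \<omega> \<noteq> 0}"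

definition sup_norm :: "'a topology \<Rightarrow> ('a \<Rightarrow> 'x::real_normed_vector) \<Rightarrow> ennreal" where
  "sup_norm \<Omega> f = (SUP \<omega>\<in>topspace \<Omega>. ennreal (norm (f \<omega>)))"

definition cont_b_funs :: "'a topology \<Rightarrow> 'x::real_normed_vector set \<Rightarrow> ('a \<Rightarrow> 'x) set" where
  "cont_b_funs \<Omega> S = {f \<in> cont_funs \<Omega> S. bounded (f ` topspace \<Omega>)}"

definition cont_0_funs :: "'a topology \<Rightarrow> 'x::real_normed_vector set \<Rightarrow> ('a \<Rightarrow> 'x) set" where
  "cont_0_funs \<Omega> S = {f \<in> cont_funs \<Omega> S. vanishes_at_infinity \<Omega> f}"

definition cont_c_funs :: "'a topology \<Rightarrow> 'x::real_normed_vector set \<Rightarrow> ('a \<Rightarrow> 'x) set" where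
  "cont_c_funs \<Omega> S = {f \<in> cont_funs \<Omega> S. compactin \<Omega> (fun_support \<Omega> f)}"

definition fun_cone :: "'a topology \<Rightarrow> ('a \<Rightarrow> 'x::real_vector) set \<Rightarrow> bool" where
  "fun_cone \<Omega> F \<longleftrightarrow>
     (\<forall>f\<in>F. \<forall>g\<in>F. (\<lambda>\<omega>\<in>topspace \<Omega>. f \<omega> + g \<omega>) \<in> F) \<and>
     (\<forall>r\<ge>0. \<forall>f\<in>F. (\<lambda>\<omega>\<in>topspace \<Omega>. r *\<^sub>R f \<omega>) \<in> F)"

definition fun_sum :: "'a topology \<Rightarrow> 'i set \<Rightarrow> ('i \<Rightarrow> ('a \<Rightarrow> 'x::real_vector) set) \<Rightarrow> ('a \<Rightarrow> 'x) set" where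
  "fun_sum \<Omega> I F = {(\<lambda>\<omega>\<in>topspace \<Omega>. \<Sum>i\<in>I. g i \<omega>) | g. \<forall>i\<in>I. g i \<in> F i}"

text \<open>
  The metric space \<^term>\<open>cfunspace \<Omega> euclidean_metric\<close> carries the distance of the sup-norm;
  its points are the bounded continuous functions, and it contains the other two normed spaces.
\<close>

definition sup_norm_topology :: "'a topology \<Rightarrow> ('a \<Rightarrow> 'x::real_normed_vector) topology" where
  "sup_norm_topology \<Omega> = mtopology_of (cfunspace \<Omega> euclidean_metric)"

definition closed_in_normed :: "'a topology \<Rightarrow> ('a \<Rightarrow> 'x::real_normed_vector) set \<Rightarrow> ('a \<Rightarrow> 'x) set \<Rightarrow> bool" where
  "closed_in_normed \<Omega> V F \<longleftrightarrow> closedin (subtopology (sup_norm_topology \<Omega>) V) F"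

lemma topspace_sup_norm_topology: "topspace (sup_norm_topology \<Omega>) = cont_b_funs \<Omega> UNIV"
  unfolding sup_norm_topology_def cont_b_funs_def cont_funs_def
  by (auto simp: Met_TC.mbounded_def bounded_def subset_iff)

lemma sup_norm_diff_eq_mdist:
  fixes f g :: "'a \<Rightarrow> 'x::real_normed_vector"
  assumes f: "f \<in> cont_b_funs \<Omega> UNIV" and g: "g \<in> cont_b_funs \<Omega> UNIV"
  shows "sup_norm \<Omega> (\<lambda>\<omega>. f \<omega> - g \<omega>) = ennreal (mdist (cfunspace \<Omega> euclidean_metric) f g)"
proof (cases "topspace \<Omega> = {}")
  case True
  then show ?thesis
    by (simp add: sup_norm_def cfunspace_def Met_TC.fdist_def Metric_space.fdist_def bot_ennreal)
next
  case False
  let ?d = "mdist (cfunspace \<Omega> euclidean_metric) f g"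
  have fg: "f \<in> mspace (cfunspace \<Omega> euclidean_metric)" "g \<in> mspace (cfunspace \<Omega> euclidean_metric)"
    using f g topspace_sup_norm_topology[of \<Omega>, where 'b='x] by (simp_all add: sup_norm_topology_def)
  have le: "?d \<le> a \<longleftrightarrow> (\<forall>\<omega>\<in>topspace \<Omega>. norm (f \<omega> - g \<omega>) \<le> a)" for a
    using cfunspace_mdist_le[OF fg False, of a] by (simp add: dist_norm)
  show ?thesis
  proof (rule antisym)
    show "sup_norm \<Omega> (\<lambda>\<omega>. f \<omega> - g \<omega>) \<le> ennreal ?d"
      unfolding sup_norm_def using le[of ?d] by (auto intro!: SUP_least ennreal_leI)
    show "ennreal ?d \<le> sup_norm \<Omega> (\<lambda>\<omega>. f \<omega> - g \<omega>)"
    proof (cases "sup_norm \<Omega> (\<lambda>\<omega>. f \<omega> - g \<omega>)")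
      case (real r)
      have "norm (f \<omega> - g \<omega>) \<le> r" if "\<omega> \<in> topspace \<Omega>" for \<omega>
        using SUP_upper[OF that, of "\<lambda>\<omega>. ennreal (norm (f \<omega> - g \<omega>))"] real
        by (simp add: sup_norm_def ennreal_le_iff)
      then show ?thesis
        using real le[of r] by (simp add: ennreal_leI)
    qed simp
  qed
qed

lemma cont_0_funs_subset: "cont_0_funs \<Omega> S \<subseteq> cont_b_funs \<Omega> S"
proof
  fix f assume f: "f \<in> cont_0_funs \<Omega> S"
  let ?A = "{\<omega> \<in> topspace \<Omega>. norm (f \<omega>) \<ge> 1}"
  have c: "continuous_map \<Omega> euclidean f" and "compactin \<Omega> ?A"
    using f by (auto simp: cont_0_funs_def cont_funs_def vanishes_at_infinity_def continuous_map_in_subtopology)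
  then have "bounded (f ` ?A)"
    using image_compactin[of \<Omega> ?A euclidean f] compact_imp_bounded by auto
  moreover have "f ` topspace \<Omega> \<subseteq> f ` ?A \<union> cball 0 1"
    by auto
  ultimately have "bounded (f ` topspace \<Omega>)"
    by (meson bounded_Un bounded_cball bounded_subset)
  then show "f \<in> cont_b_funs \<Omega> S"
    using f by (simp add: cont_0_funs_def cont_b_funs_def)
qed

lemma cont_c_funs_subset: "cont_c_funs \<Omega> S \<subseteq> cont_0_funs \<Omega> S"
proof
  fix f assume f: "f \<in> cont_c_funs \<Omega> S"
  then have c: "continuous_map \<Omega> euclidean f" and K: "compactin \<Omega> (fun_support \<Omega> f)"
    by (auto simp: cont_c_funs_def cont_funs_def continuous_map_in_subtopology)
  have "compactin \<Omega> {\<omega> \<in> topspace \<Omega>. norm (f \<omega>) \<ge> \<epsilon>}" if "\<epsilon> > 0" for \<epsilon>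
  proof (rule closed_compactin[OF K])
    have "{\<omega> \<in> topspace \<Omega>. norm (f \<omega>) \<ge> \<epsilon>} \<subseteq> {\<omega> \<in> topspace \<Omega>. f \<omega> \<noteq> 0}"
      using that by auto
    then show "{\<omega> \<in> topspace \<Omega>. norm (f \<omega>) \<ge> \<epsilon>} \<subseteq> fun_support \<Omega> f"
      using closure_of_subset[of "{\<omega> \<in> topspace \<Omega>. f \<omega> \<noteq> 0}" \<Omega>]
      unfolding fun_support_def by blast
    have "closed {x::'b. norm x \<ge> \<epsilon>}"
      by (intro closed_Collect_le continuous_intros)
    then show "closedin \<Omega> {\<omega> \<in> topspace \<Omega>. norm (f \<omega>) \<ge> \<epsilon>}"
      using closedin_continuous_map_preimage[OF c, of "{x. norm x \<ge> \<epsilon>}"] by simp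
  qed
  with f show "f \<in> cont_0_funs \<Omega> S"
    by (simp add: cont_0_funs_def cont_c_funs_def vanishes_at_infinity_def)
qed

end

theory Submission
  imports Defs
begin

text \<open>
  Everything reduces to the space \<open>X\<close> itself: it suffices to find continuous, positively homogeneous
  maps \<open>\<gamma> i\<close> from \<open>X\<close> to \<open>C i\<close> with \<open>x = (\<Sum>i. \<gamma> i x)\<close> and
  \<open>(\<Sum>i. norm (\<gamma> i x)) \<le> K * norm x\<close> for every \<open>x\<close>. A function \<open>f\<close> is then decomposed into the functions
  \<open>\<gamma> i \<circ> f\<close>. They are dominated by \<open>K * norm f\<close>, which gives the assertions on norms, supports and
  decay, and the last assertion on \<open>f\<close> is the homogeneity of \<open>\<gamma> i\<close>. For finite \<open>I\<close>, the four
  function spaces are cut out by properties that pass to dominated functions and to sums, so they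
  are treated alike.

  The maps \<open>\<gamma> i\<close> come from a combination of the open mapping theorem with a selection argument.

  By Baire's theorem, every vector of the unit ball is within \<open>1 / 4\<close> of one that has a decomposition with
  a fixed bound \<open>M\<close> (lemma \<open>ex_uniform_approximate_decomposition\<close>).

  Choosing such a decomposition for every direction and averaging with weights concentrated on the
  directions near that of \<open>x\<close> gives a continuous homogeneous decomposition of a vector \<open>q x\<close> with
  \<open>norm (x - q x) \<le> norm x / 2\<close> (lemma \<open>ex_approximate_selection\<close>). Iterating on the error
  \<open>x - q x\<close> and adding up the results removes the error (lemma
  \<open>ex_continuous_homogeneous_selection\<close>). All these sums stay in the cones because the cones are
  closed and convex.

  The weights would usually come from paracompactness of the unit sphere. Here they come from
  a well-order of \<open>X\<close> (lemma \<open>ex_partition_of_norm\<close>): uniformly Lipschitz bumps around all directions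
  have supremum \<open>norm x\<close>, and the increments of their running supremum along the well-order are
  again Lipschitz and sum to \<open>norm x\<close>. These weights need not be locally finite, but
  nonnegative continuous weights with a continuous sum are continuous as a map to \<open>\<ell>\<^sup>1\<close>
  (lemma \<open>continuous_on_infsum_scaleR\<close>), which is all the averaging requires.
\<close>

section \<open>A homogeneous partition of the norm\<close>

text \<open>
  In the application, \<open>r\<close> is a strict well-order and \<open>f\<close> is bounded and nonnegative.
  Inserting \<open>0\<close> makes the supremum meaningful at the least index and then changes nothing elsewhere.
\<close>

definition sup_before :: "'a rel \<Rightarrow> ('a \<Rightarrow> real) \<Rightarrow> 'a \<Rightarrow> real" where
  "sup_before r f a = Sup (insert 0 (f ` {b. (b, a) \<in> r}))"

text \<open>
  The amount by which the running supremum of \<open>f\<close> increases at \<open>a\<close>: only an index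
  whose value exceeds the supremum of all earlier ones contributes. These increments telescope along the
  well-order, so they split the supremum of \<open>f\<close> into a sum, and each is dominated by the corresponding value of \<open>f\<close>.
\<close>

definition excess :: "'a rel \<Rightarrow> ('a \<Rightarrow> real) \<Rightarrow> 'a \<Rightarrow> real" where
  "excess r f a = max 0 (f a - sup_before r f a)"

lemma excess_nonneg: "0 \<le> excess r f a"
  by (simp add: excess_def)

lemma sup_before_upper:
  assumes "\<And>b. f b \<le> S" "(b, a) \<in> r"
  shows "f b \<le> sup_before r f a"
  unfolding sup_before_def
  using assms by (intro cSup_upper) (auto intro!: bdd_aboveI[of _ "max 0 S"] simp: max.coboundedI2)

lemma sup_before_nonneg:
  assumes "\<And>b. f b \<le> S"
  shows "0 \<le> sup_before r f a"
  unfolding sup_before_def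
  using assms by (intro cSup_upper) (auto intro!: bdd_aboveI[of _ "max 0 S"] simp: max.coboundedI2)

lemma sup_before_least:
  assumes "0 \<le> M" "\<And>b. (b, a) \<in> r \<Longrightarrow> f b \<le> M"
  shows "sup_before r f a \<le> M"
  unfolding sup_before_def using assms by (intro cSup_least) auto

lemma excess_le:
  assumes "\<And>b. f b \<le> S" "0 \<le> f a"
  shows "excess r f a \<le> f a"
  using sup_before_nonneg[of f S r a] assms by (simp add: excess_def)

text \<open>
  Forming a supremum does not increase uniform distances. Hence a family of functions with a common
  Lipschitz constant has increments with a common Lipschitz constant, however large the index set.
\<close>

lemma excess_dist_le:
  assumes "\<And>b. f b \<le> S" "\<And>b. g b \<le> T" and d: "\<And>b. \<bar>f b - g b\<bar> \<le> d"
  shows "\<bar>excess r f a - excess r g a\<bar> \<le> 2 * d"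
proof -
  have "0 \<le> d"
    using d[of a] by linarith
  have *: "sup_before r f a \<le> sup_before r g a + d"
    if "\<And>b. f b \<le> S" "\<And>b. g b \<le> T" "\<And>b. \<bar>f b - g b\<bar> \<le> d" for f g :: "'a \<Rightarrow> real" and S T
  proof (rule sup_before_least)
    show "0 \<le> sup_before r g a + d"
      using sup_before_nonneg[of g T r a] that(2) \<open>0 \<le> d\<close> by simp
    fix b assume "(b, a) \<in> r"
    then show "f b \<le> sup_before r g a + d"
      using sup_before_upper[of g T b a r] that(2) that(3)[of b] by fastforce
  qed
  have "sup_before r f a \<le> sup_before r g a + d" "sup_before r g a \<le> sup_before r f a + d"
    using *[OF assms] *[OF assms(2,1)] d by (simp_all add: abs_minus_commute)
  then show ?thesis
    using d[of a] unfolding excess_def by linarith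
qed

lemma sup_before_scale:
  assumes "\<And>b. f b \<le> S" and "0 < t"
  shows "sup_before r (\<lambda>a. t * f a) a = t * sup_before r f a"
proof (rule antisym)
  show "sup_before r (\<lambda>a. t * f a) a \<le> t * sup_before r f a"
    using assms sup_before_nonneg[of f S r a] sup_before_upper[of f S _ a r]
    by (intro sup_before_least) (auto simp: mult_left_mono)
  have le: "t * f b \<le> t * S" for b
    using assms by (simp add: mult_left_mono)
  have "sup_before r f a \<le> sup_before r (\<lambda>a. t * f a) a / t"
    using sup_before_nonneg[of "\<lambda>a. t * f a" "t * S" r a] sup_before_upper[of "\<lambda>a. t * f a" "t * S" _ a r] le \<open>0 < t\<close>
    by (intro sup_before_least) (auto simp: field_simps)
  then show "t * sup_before r f a \<le> sup_before r (\<lambda>a. t * f a) a"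
    using \<open>0 < t\<close> by (simp add: field_simps)
qed

lemma excess_scale:
  assumes "\<And>b. f b \<le> S" and "0 \<le> t"
  shows "excess r (\<lambda>a. t * f a) a = t * excess r f a"
proof (cases "t = 0")
  case True
  then show ?thesis
    by (auto simp: excess_def sup_before_def image_constant_conv)
next
  case False
  then show ?thesis
    using assms sup_before_scale[of f S t r a]
    by (simp add: excess_def max_def right_diff_distrib[symmetric] mult_le_0_iff zero_le_mult_iff)
qed

text \<open>
  Upper half of the telescoping. Only the greatest index \<open>m\<close> of the finite set needs attention: if its
  increment vanishes, it can be dropped; otherwise the terms before \<open>m\<close> add up to at most the
  supremum before \<open>m\<close>, and the increment at \<open>m\<close> raises this exactly to \<open>f m\<close>.
\<close>

lemma sum_excess_le:
  assumes r: "trans r" "total r" and f: "\<And>b. f b \<le> S" and "finite F"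
    and M: "0 \<le> M" "\<And>b. b \<in> F \<Longrightarrow> f b \<le> M"
  shows "sum (excess r f) F \<le> M"
  using \<open>finite F\<close> M
proof (induction F arbitrary: M rule: finite_psubset_induct)
  case (psubset F)
  show ?case
  proof (cases "F = {}")
    case False
    have "\<exists>m\<in>F. \<forall>b\<in>F. b \<noteq> m \<longrightarrow> (b, m) \<in> r"
      using \<open>finite F\<close> False
    proof (induction F rule: finite_ne_induct)
      case (insert x F)
      then obtain m where m: "m \<in> F" "\<forall>b\<in>F. b \<noteq> m \<longrightarrow> (b, m) \<in> r"
        by blast
      have "m \<noteq> x"
        using m(1) insert.hyps by blast
      then have "(m, x) \<in> r \<or> (x, m) \<in> r"
        using r(2) by (simp add: total_on_def)
      then show ?case
      proof
        assume "(m, x) \<in> r"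
        then have "(b, x) \<in> r" if "b \<in> F" for b
          using that m(2) r(1) by (cases "b = m") (auto dest: transD)
        then show ?thesis
          by auto
      qed (use m in auto)
    qed auto
    then obtain m where m: "m \<in> F" "\<And>b. b \<in> F \<Longrightarrow> b \<noteq> m \<Longrightarrow> (b, m) \<in> r"
      by blast
    have split: "sum (excess r f) F = excess r f m + sum (excess r f) (F - {m})"
      using m(1) psubset.hyps by (simp add: sum.remove)
    have sub: "F - {m} \<subset> F"
      using m(1) by blast
    show ?thesis
    proof (cases "excess r f m = 0")
      case True
      have "sum (excess r f) (F - {m}) \<le> M"
        using sub psubset.prems by (intro psubset.IH) auto
      then show ?thesis
        using True split by simp
    next
      case False
      have "sum (excess r f) (F - {m}) \<le> sup_before r f m"
      proof (rule psubset.IH[OF sub])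
        show "0 \<le> sup_before r f m"
          using f by (rule sup_before_nonneg)
      qed (use m(2) in \<open>auto intro!: sup_before_upper[of f S, OF f]\<close>)
      moreover have "excess r f m = f m - sup_before r f m"
        using False by (simp add: excess_def max_def split: if_splits)
      ultimately show ?thesis
        using psubset.prems(2)[OF m(1)] split by linarith
    qed
  qed (use psubset.prems in simp)
qed

text \<open>
  The upper bound comes from the finite sums. The lower bound is a well-founded induction: if every
  \<open>f b\<close> with \<open>b\<close> before \<open>a\<close> is at most the sum of the increments up to \<open>b\<close>, then the supremum
  of these values is at most the sum of the increments before \<open>a\<close>, and the increment at \<open>a\<close>
  bridges the gap to \<open>f a\<close>.
\<close>

lemma excess_has_sum:
  assumes r: "wf r" "trans r" "total r" and f: "\<And>b. 0 \<le> f b" "\<And>b. f b \<le> f m"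
  shows "(excess r f has_sum f m) UNIV"
proof -
  have bd: "sum (excess r f) F \<le> f m" if "finite F" for F
    using f by (intro sum_excess_le[OF r(2,3) f(2) that]) auto
  have summable: "excess r f summable_on A" for A
    using bd by (intro nonneg_bdd_above_summable_on excess_nonneg bdd_aboveI2[of _ _ "f m"]) auto
  have f_le: "f a \<le> infsum (excess r f) (insert a {b. (b, a) \<in> r})" for a
  proof (induction a rule: wf_induct_rule[OF r(1)])
    case (1 a)
    let ?B = "{b. (b, a) \<in> r}"
    have "sup_before r f a \<le> infsum (excess r f) ?B"
    proof (rule sup_before_least)
      fix b assume b: "(b, a) \<in> r"
      have "f b \<le> infsum (excess r f) (insert b {c. (c, b) \<in> r})"
        using 1 b by blast
      also have "\<dots> \<le> infsum (excess r f) ?B"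
        using b r(2) by (intro infsum_mono2 summable excess_nonneg) (auto dest: transD)
      finally show "f b \<le> infsum (excess r f) ?B" .
    qed (simp add: infsum_nonneg excess_nonneg)
    moreover have "infsum (excess r f) (insert a ?B) = excess r f a + infsum (excess r f) ?B"
      using r(1) by (intro infsum_insert summable) auto
    moreover have "f a \<le> excess r f a + sup_before r f a"
      by (simp add: excess_def)
    ultimately show ?case
      by linarith
  qed
  have "infsum (excess r f) UNIV = f m"
  proof (rule antisym)
    show "infsum (excess r f) UNIV \<le> f m"
      using bd by (intro infsum_le_finite_sums summable) auto
    have "f m \<le> infsum (excess r f) (insert m {b. (b, m) \<in> r})"
      by (rule f_le)
    also have "\<dots> \<le> infsum (excess r f) UNIV"
      by (intro infsum_mono2 summable excess_nonneg) auto
    finally show "f m \<le> infsum (excess r f) UNIV" .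
  qed
  then show ?thesis
    using summable[of UNIV] by (simp add: has_sum_iff)
qed

text \<open>
  This takes the place of a locally finite partition of unity on the unit sphere. The tent functions
  \<open>f x a\<close> below are positively homogeneous and Lipschitz in \<open>x\<close> uniformly in \<open>a\<close>, and live where the
  direction of \<open>x\<close> is near that of \<open>a\<close>. Their supremum over \<open>a\<close> is \<open>norm x\<close>, attained at \<open>a = x\<close>,
  so their increments along a well-order of the space sum to \<open>norm x\<close>. Local finiteness is lost, but
  nonnegativity and the continuity of the sum are enough for what follows. Writing \<open>sgn a\<close> lets \<open>a\<close>
  range over the whole space, including \<open>0\<close>.
\<close>

lemma ex_partition_of_norm:
  obtains h :: "'x::real_normed_vector \<Rightarrow> 'x \<Rightarrow> real"
  where "\<And>a x. 0 \<le> h a x"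
    and "\<And>a. continuous_on UNIV (h a)"
    and "\<And>x. ((\<lambda>a. h a x) has_sum norm x) UNIV"
    and "\<And>a t x. 0 \<le> t \<Longrightarrow> h a (t *\<^sub>R x) = t * h a x"
    and "\<And>a x. h a x \<noteq> 0 \<Longrightarrow> norm (x - norm x *\<^sub>R sgn a) \<le> norm x / 4"
proof -
  obtain r0 :: "'x rel" where r0: "Well_order r0" "Field r0 = UNIV"
    using well_ordering[where 'a='x] by auto
  define r where "r = r0 - Id"
  have r: "wf r" "trans r" "total r"
    using r0 by (auto simp: r_def well_order_on_def linear_order_on_def partial_order_on_def
        preorder_on_def trans_diff_Id)
  \<comment> \<open>The slope \<open>4\<close> makes \<open>f x a\<close> vanish once the directions are more than \<open>1 / 4\<close> apart.\<close>
  define f :: "'x \<Rightarrow> 'x \<Rightarrow> real"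
    where "f x a = max 0 (norm x - 4 * norm (x - norm x *\<^sub>R sgn a))" for x a
  have f0: "0 \<le> f x a" and fle: "f x a \<le> norm x" for x a
    by (auto simp: f_def)
  have fx: "f x x = norm x" for x
    using norm_ge_zero[of x] by (cases "x = 0") (simp_all add: f_def sgn_div_norm)
  have fscale: "f (t *\<^sub>R x) = (\<lambda>a. t * f x a)" if "0 \<le> t" for t x
  proof
    fix a
    have "t *\<^sub>R x - norm (t *\<^sub>R x) *\<^sub>R sgn a = t *\<^sub>R (x - norm x *\<^sub>R sgn a)"
      using that by (simp add: scaleR_right_diff_distrib)
    then have "f (t *\<^sub>R x) a = max 0 (t * (norm x - 4 * norm (x - norm x *\<^sub>R sgn a)))"
      using that by (simp add: f_def right_diff_distrib)
    then show "f (t *\<^sub>R x) a = t * f x a"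
      using that by (simp add: f_def max_mult_distrib_left)
  qed
  have flip: "\<bar>f x a - f y a\<bar> \<le> 9 * norm (x - y)" for x y a
  proof -
    have "norm ((x - norm x *\<^sub>R sgn a) - (y - norm y *\<^sub>R sgn a))
        = norm ((x - y) - (norm x - norm y) *\<^sub>R sgn a)"
      by (simp add: algebra_simps)
    also have "\<dots> \<le> norm (x - y) + \<bar>norm x - norm y\<bar> * norm (sgn a)"
      by (metis norm_scaleR norm_triangle_ineq4)
    also have "\<dots> \<le> norm (x - y) + norm (x - y) * 1"
      by (intro add_left_mono mult_mono) (auto simp: norm_triangle_ineq3 norm_sgn)
    finally have "\<bar>norm (x - norm x *\<^sub>R sgn a) - norm (y - norm y *\<^sub>R sgn a)\<bar> \<le> 2 * norm (x - y)"
      using norm_triangle_ineq3 order_trans by fastforce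
    then show ?thesis
      using norm_triangle_ineq3[of x y] unfolding f_def by linarith
  qed
  show ?thesis
  proof
    show "0 \<le> excess r (f x) a" for a x
      by (rule excess_nonneg)
    \<comment> \<open>Twice the Lipschitz constant \<open>1 + 4 * 2 = 9\<close> of the tents.\<close>
    have "18-lipschitz_on UNIV (\<lambda>x. excess r (f x) a)" for a
      using excess_dist_le[OF fle fle flip, where r = r and a = a] by (intro lipschitz_onI) (auto simp: dist_norm)
    then show "continuous_on UNIV (\<lambda>x. excess r (f x) a)" for a
      by (rule lipschitz_on_continuous_on)
    show "(excess r (f x) has_sum norm x) UNIV" for x
      using excess_has_sum[OF r, of "f x" x] f0 fle fx by simp
    show "excess r (f (t *\<^sub>R x)) a = t * excess r (f x) a" if "0 \<le> t" for t x a
      using fscale[OF that] excess_scale[OF fle that] by simp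
    show "norm (x - norm x *\<^sub>R sgn a) \<le> norm x / 4" if "excess r (f x) a \<noteq> 0" for a x
    proof -
      have "0 < f x a"
        using that excess_le[of "f x" "norm x" a r] fle f0 excess_nonneg[of r "f x" a]
        by (smt (verit))
      then show ?thesis
        by (simp add: f_def max_def split: if_splits)
    qed
  qed
qed

text \<open>
  The argument of Scheffe's lemma: coefficients that are nonnegative and continuous one by one, with
  a continuous sum, depend continuously on the point in the sense of \<open>\<ell>\<^sup>1\<close>. A finite set
  \<open>F\<close> carrying most of the mass at \<open>x\<close> carries most of it near \<open>x\<close>, as its mass and the total mass
  are both continuous; so the tail outside \<open>F\<close> is uniformly small near \<open>x\<close>.
\<close>

lemma continuous_on_infsum_scaleR:
  fixes h :: "'a \<Rightarrow> 'x::metric_space \<Rightarrow> real" and v :: "'a \<Rightarrow> 'y::banach"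
  assumes h: "\<And>a x. 0 \<le> h a x" "\<And>a. continuous_on UNIV (h a)"
    and n: "\<And>x. ((\<lambda>a. h a x) has_sum n x) UNIV" "continuous_on UNIV n"
    and v: "\<And>a. norm (v a) \<le> B"
  shows "continuous_on UNIV (\<lambda>x. \<Sum>\<^sub>\<infinity>a. h a x *\<^sub>R v a)"
proof -
  have "0 \<le> B"
    using v norm_ge_zero order_trans by blast
  define \<Phi> where "\<Phi> x = (\<Sum>\<^sub>\<infinity>a. h a x *\<^sub>R v a)" for x
  have abs: "(\<lambda>a. h a x *\<^sub>R v a) abs_summable_on A" for x A
  proof (rule Infinite_Sum.abs_summable_on_comparison_test')
    show "(\<lambda>a. h a x * B) summable_on A"
      using has_sum_imp_summable[OF n(1)[of x]]
      by (intro summable_on_cmult_left) (rule summable_on_subset_banach, auto)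
  qed (use h(1) v in \<open>auto intro!: mult_left_mono\<close>)
  have tail: "norm (\<Phi> x - (\<Sum>a\<in>F. h a x *\<^sub>R v a)) \<le> (n x - (\<Sum>a\<in>F. h a x)) * B"
    if "finite F" for x F
  proof -
    have 1: "((\<lambda>a. h a x *\<^sub>R v a) has_sum (\<Phi> x - (\<Sum>a\<in>F. h a x *\<^sub>R v a))) (UNIV - F)"
      using that unfolding \<Phi>_def
      by (intro has_sum_Diff has_sum_infsum has_sum_finite abs_summable_summable[OF abs]) auto
    have 2: "((\<lambda>a. h a x * B) has_sum (n x - (\<Sum>a\<in>F. h a x)) * B) (UNIV - F)"
      using that n(1) by (intro has_sum_cmult_left has_sum_Diff has_sum_finite) auto
    have "norm (\<Phi> x - (\<Sum>a\<in>F. h a x *\<^sub>R v a)) \<le> (\<Sum>\<^sub>\<infinity>a\<in>UNIV - F. norm (h a x *\<^sub>R v a))"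
      using abs by (intro norm_has_sum_bound[OF _ 1] has_sum_infsum)
    also have "\<dots> \<le> (n x - (\<Sum>a\<in>F. h a x)) * B"
      using h(1) v by (intro has_sum_mono[OF has_sum_infsum[OF abs] 2]) (auto intro!: mult_left_mono)
    finally show ?thesis .
  qed
  have "isCont \<Phi> x" for x
    unfolding isCont_def
  proof (rule tendstoI)
    fix e :: real assume "0 < e"
    obtain F where F: "finite F" "dist (\<Sum>a\<in>F. h a x) (n x) \<le> e / (4 * (B + 1))"
      using has_sum_finite_approximation[OF n(1)[of x], of "e / (4 * (B + 1))"] \<open>0 \<le> B\<close> \<open>0 < e\<close>
      by auto
    let ?t = "\<lambda>y. (n y - (\<Sum>a\<in>F. h a y)) * B" and ?S = "\<lambda>y. \<Sum>a\<in>F. h a y *\<^sub>R v a"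
    have "?t x \<le> e / (4 * (B + 1)) * B"
      using F(2) \<open>0 \<le> B\<close> by (intro mult_right_mono) (auto simp: dist_real_def)
    also have "\<dots> < e / 3"
      using \<open>0 \<le> B\<close> \<open>0 < e\<close> by (simp add: field_simps add_nonneg_pos)
    finally have tx: "?t x < e / 3" .
    have "isCont ?t x" "isCont ?S x"
      using h(2) n(2) by (auto intro!: continuous_intros simp: continuous_on_eq_continuous_at)
    then have "(?t \<longlongrightarrow> ?t x) (at x)" "(?S \<longlongrightarrow> ?S x) (at x)"
      by (simp_all add: isCont_def)
    then have "\<forall>\<^sub>F y in at x. ?t y < e / 3" "\<forall>\<^sub>F y in at x. dist (?S y) (?S x) < e / 3"
      using tx \<open>0 < e\<close> by (auto intro!: order_tendstoD(2) tendstoD simp del: less_divide_eq_numeral1)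
    then show "\<forall>\<^sub>F y in at x. dist (\<Phi> y) (\<Phi> x) < e"
    proof eventually_elim
      case (elim y)
      have "dist (\<Phi> y) (?S y) < e / 3" "dist (?S x) (\<Phi> x) < e / 3"
        using tail[OF F(1), of y] tail[OF F(1), of x] tx elim by (simp_all add: dist_norm norm_minus_commute)
      with elim(2) show ?case
        by metric
    qed
  qed
  then show ?thesis
    unfolding \<Phi>_def[symmetric] by (simp add: continuous_on_eq_continuous_at)
qed

section \<open>Absolutely convergent decompositions\<close>

text \<open>
  The bound \<open>M\<close> is carried along as a parameter: sums of decompositions only ever produce upper
  bounds of the \<open>\<ell>\<^sup>1\<close> norm.
\<close>

definition cone_decomposition ::
  "'i set \<Rightarrow> ('i \<Rightarrow> 'x::banach set) \<Rightarrow> 'x \<Rightarrow> real \<Rightarrow> ('i \<Rightarrow> 'x) \<Rightarrow> bool" where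
  "cone_decomposition I C x M c \<longleftrightarrow> (\<forall>i\<in>I. c i \<in> C i) \<and> c abs_summable_on I \<and> (c has_sum x) I \<and>
     (\<Sum>\<^sub>\<infinity>i\<in>I. norm (c i)) \<le> M"

lemma cone_decomposition_mono:
  "cone_decomposition I C x M c \<Longrightarrow> M \<le> N \<Longrightarrow> cone_decomposition I C x N c"
  by (auto simp: cone_decomposition_def)

lemma cone_decomposition_norm_le:
  assumes "cone_decomposition I C x M c" "i \<in> I"
  shows "norm (c i) \<le> M"
proof -
  have "norm (c i) = (\<Sum>\<^sub>\<infinity>j\<in>{i}. norm (c j))"
    by simp
  also have "\<dots> \<le> (\<Sum>\<^sub>\<infinity>j\<in>I. norm (c j))"
    using assms by (intro infsum_mono2) (auto simp: cone_decomposition_def)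
  finally show ?thesis
    using assms by (auto simp: cone_decomposition_def)
qed

lemma cone_decomposition_norm_sum_le:
  assumes "cone_decomposition I C x M c"
  shows "norm x \<le> M"
  using assms norm_has_sum_bound[OF has_sum_infsum, of c I x] unfolding cone_decomposition_def by fastforce

lemma additive_cone_add: "additive_cone C \<Longrightarrow> x \<in> C \<Longrightarrow> y \<in> C \<Longrightarrow> x + y \<in> C"
  unfolding additive_cone_def by (meson set_plus_intro subsetD)

lemma additive_cone_scaleR: "additive_cone C \<Longrightarrow> x \<in> C \<Longrightarrow> 0 \<le> t \<Longrightarrow> t *\<^sub>R x \<in> C"
  unfolding additive_cone_def by blast

lemma additive_cone_zero: "additive_cone C \<Longrightarrow> x \<in> C \<Longrightarrow> 0 \<in> C"
  using additive_cone_scaleR[of C x 0] by simp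

text \<open>
  The cone is assumed nonempty because \<^const>\<open>additive_cone\<close> also holds of the empty set.
\<close>

lemma additive_cone_has_sum:
  assumes C: "additive_cone C" "closed C" "C \<noteq> {}"
    and f: "\<And>a. a \<in> A \<Longrightarrow> f a \<in> C" "(f has_sum s) A"
  shows "s \<in> C"
proof (rule Lim_in_closed_set[OF C(2) _ _ f(2)[unfolded has_sum_def]])
  have "sum f F \<in> C" if "finite F" "F \<subseteq> A" for F
    using that
    by (induction F rule: finite_induct) (use C f in \<open>auto intro: additive_cone_zero additive_cone_add\<close>)
  then show "\<forall>\<^sub>F F in finite_subsets_at_top A. sum f F \<in> C"
    by (simp add: eventually_finite_subsets_at_top_weakI)
qed simp

lemma cone_decomposition_scaleR:
  assumes "\<And>i. i \<in> I \<Longrightarrow> additive_cone (C i)" and "cone_decomposition I C x M c" and "0 \<le> t"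
  shows "cone_decomposition I C (t *\<^sub>R x) (t * M) (\<lambda>i. t *\<^sub>R c i)"
  using assms
  by (auto simp: cone_decomposition_def infsum_cmult_right' additive_cone_scaleR mult_left_mono
      summable_on_cmult_right has_sum_scaleR)

text \<open>
  The decompositions form a closed cone in \<open>\<ell>\<^sup>1\<close>, so they may be summed absolutely, over
  index sets of any size; the double series may be rearranged because it converges absolutely. Every
  construction below is such a sum: over directions to average decompositions, and over the natural
  numbers to correct errors.
\<close>

lemma cone_decomposition_infsum:
  assumes C: "\<And>i. i \<in> I \<Longrightarrow> additive_cone (C i)" "\<And>i. i \<in> I \<Longrightarrow> closed (C i)"
    and dec: "\<And>a. a \<in> A \<Longrightarrow> cone_decomposition I C (x a) (M a) (c a)"
    and ne: "\<And>i. i \<in> I \<Longrightarrow> C i \<noteq> {}"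
    and M: "(M has_sum N) A"
  shows "cone_decomposition I C (\<Sum>\<^sub>\<infinity>a\<in>A. x a) N (\<lambda>i. \<Sum>\<^sub>\<infinity>a\<in>A. c a i)"
proof -
  let ?c = "\<lambda>(a, i). c a i"
  have row: "(\<lambda>i. c a i) abs_summable_on I" "(\<Sum>\<^sub>\<infinity>i\<in>I. norm (c a i)) \<le> M a" "((\<lambda>i. c a i) has_sum x a) I" if "a \<in> A" for a
    using dec[OF that] by (auto simp: cone_decomposition_def)
  have Msum: "M summable_on A"
    using M by (rule has_sum_imp_summable)
  have "(\<lambda>a. norm (\<Sum>\<^sub>\<infinity>i\<in>I. norm (c a i))) summable_on A"
    using row(2) infsum_nonneg[of I "\<lambda>i. norm (c _ i)"]
    by (intro Infinite_Sum.abs_summable_on_comparison_test'[OF Msum]) simp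
  then have abs: "?c abs_summable_on A \<times> I"
    using row(1) by (subst Infinite_Sum.abs_summable_on_Sigma_iff) simp
  have abs': "(\<lambda>(i, a). c a i) abs_summable_on I \<times> A"
    using abs summable_on_swap[of "\<lambda>p. norm (?c p)" A I]
    by (simp add: case_prod_unfold)
  have col: "(\<lambda>a. c a i) abs_summable_on A" if "i \<in> I" for i
    using abs' that by (simp add: Infinite_Sum.abs_summable_on_Sigma_iff)
  have norms: "(\<lambda>i. \<Sum>\<^sub>\<infinity>a\<in>A. norm (c a i)) summable_on I"
    using abs' by (auto simp: Infinite_Sum.abs_summable_on_Sigma_iff infsum_nonneg)
  have le: "norm (\<Sum>\<^sub>\<infinity>a\<in>A. c a i) \<le> (\<Sum>\<^sub>\<infinity>a\<in>A. norm (c a i))" if "i \<in> I" for i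
    by (rule norm_infsum_bound[OF col[OF that]])
  have "(\<Sum>\<^sub>\<infinity>a\<in>A. c a i) \<in> C i" if "i \<in> I" for i
    using C ne dec that col[THEN abs_summable_summable]
    by (intro additive_cone_has_sum[OF _ _ _ _ has_sum_infsum]) (auto simp: cone_decomposition_def)
  moreover have sum_abs: "(\<lambda>i. \<Sum>\<^sub>\<infinity>a\<in>A. c a i) abs_summable_on I"
    by (rule Infinite_Sum.abs_summable_on_comparison_test'[OF norms le])
  moreover have "((\<lambda>i. \<Sum>\<^sub>\<infinity>a\<in>A. c a i) has_sum (\<Sum>\<^sub>\<infinity>a\<in>A. x a)) I"
  proof -
    have "(\<Sum>\<^sub>\<infinity>i\<in>I. \<Sum>\<^sub>\<infinity>a\<in>A. c a i) = (\<Sum>\<^sub>\<infinity>a\<in>A. \<Sum>\<^sub>\<infinity>i\<in>I. c a i)"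
      by (rule infsum_swap_banach[symmetric, OF abs_summable_summable[OF abs]])
    also have "\<dots> = (\<Sum>\<^sub>\<infinity>a\<in>A. x a)"
      using row(3) by (intro infsum_cong) (simp add: infsumI)
    finally show ?thesis
      using abs_summable_summable[OF sum_abs] by (simp add: has_sum_iff)
  qed
  moreover have "(\<Sum>\<^sub>\<infinity>i\<in>I. norm (\<Sum>\<^sub>\<infinity>a\<in>A. c a i)) \<le> N"
  proof -
    have "(\<Sum>\<^sub>\<infinity>i\<in>I. norm (\<Sum>\<^sub>\<infinity>a\<in>A. c a i)) \<le> (\<Sum>\<^sub>\<infinity>i\<in>I. \<Sum>\<^sub>\<infinity>a\<in>A. norm (c a i))"
      using sum_abs norms le by (rule infsum_mono)
    also have "\<dots> = (\<Sum>\<^sub>\<infinity>a\<in>A. \<Sum>\<^sub>\<infinity>i\<in>I. norm (c a i))"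
      using abs by (intro infsum_swap_banach[symmetric]) (simp add: case_prod_unfold)
    also have "\<dots> \<le> N"
      using row(1,2) abs unfolding Infinite_Sum.abs_summable_on_Sigma_iff
      by (intro has_sum_mono[OF has_sum_infsum M]) (auto simp: infsum_nonneg)
    finally show ?thesis .
  qed
  ultimately show ?thesis
    by (simp add: cone_decomposition_def)
qed

lemma cone_decomposition_add:
  assumes C: "\<And>i. i \<in> I \<Longrightarrow> additive_cone (C i)"
    and x: "cone_decomposition I C x M c" and y: "cone_decomposition I C y N d"
  shows "cone_decomposition I C (x + y) (M + N) (\<lambda>i. c i + d i)"
proof -
  have s: "(\<lambda>i. norm (c i) + norm (d i)) summable_on I"
    using x y by (intro summable_on_add) (auto simp: cone_decomposition_def)
  then have abs: "(\<lambda>i. c i + d i) abs_summable_on I"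
    by (rule Infinite_Sum.abs_summable_on_comparison_test') (rule norm_triangle_ineq)
  have "(\<Sum>\<^sub>\<infinity>i\<in>I. norm (c i + d i)) \<le> (\<Sum>\<^sub>\<infinity>i\<in>I. norm (c i) + norm (d i))"
    by (intro infsum_mono abs s norm_triangle_ineq)
  also have "\<dots> = (\<Sum>\<^sub>\<infinity>i\<in>I. norm (c i)) + (\<Sum>\<^sub>\<infinity>i\<in>I. norm (d i))"
    using x y by (intro infsum_add) (auto simp: cone_decomposition_def)
  finally show ?thesis
    using C x y abs by (auto simp: cone_decomposition_def intro: additive_cone_add has_sum_add)
qed

text \<open>
  The part of the open mapping theorem that is needed. The sets \<open>A n\<close> of vectors with a decomposition of
  norm at most \<open>n\<close> cover the space, so by Baire the closure of one of them contains a ball. As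
  a cone need not be symmetric, the ball cannot be centred by taking negatives; instead a decomposition of minus
  its centre \<open>a\<close> is added. An approximation is enough here, since the error is removed later, when the
  selection is already continuous.
\<close>

lemma ex_uniform_approximate_decomposition:
  fixes C :: "'i \<Rightarrow> 'x::banach set"
  assumes C: "\<And>i. i \<in> I \<Longrightarrow> additive_cone (C i)"
    and dec: "\<And>x. \<exists>c. (\<forall>i\<in>I. c i \<in> C i) \<and> c abs_summable_on I \<and> (c has_sum x) I"
  obtains M where "0 < M"
    and "\<And>x. norm x \<le> 1 \<Longrightarrow> \<exists>y c. cone_decomposition I C y M c \<and> norm (x - y) \<le> 1 / 4"
proof -
  define A where "A n = {x. \<exists>c. cone_decomposition I C x (real n) c}" for n
  have ex: "\<exists>n. x \<in> A n" for x
  proof -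
    obtain c :: "'i \<Rightarrow> 'x" where c: "\<forall>i\<in>I. c i \<in> C i" "c abs_summable_on I" "(c has_sum x) I"
      using dec by blast
    moreover obtain n where "(\<Sum>\<^sub>\<infinity>i\<in>I. norm (c i)) \<le> real n"
      using real_arch_simple by blast
    ultimately show ?thesis
      unfolding A_def cone_decomposition_def by blast
  qed
  have "\<exists>n. interior (closure (A n)) \<noteq> {}"
  proof (rule ccontr)
    assume "\<not> ?thesis"
    then have "Met_TC.mtopology interior_of \<Union>(range (\<lambda>n. closure (A n))) = {}"
      by (intro Met_TC.metric_Baire_category_alt) (auto simp: complete_UNIV)
    moreover have "\<Union>(range (\<lambda>n. closure (A n))) = UNIV"
      using ex by (auto simp: set_eq_iff) (meson closure_subset subsetD)
    ultimately show False
      by simp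
  qed
  then obtain n a r where "0 < r" and r: "cball a r \<subseteq> closure (A n)"
    by (metis all_not_in_conv mem_interior_cball)
  obtain m where "- a \<in> A m"
    using ex by blast
  then obtain d where d: "cone_decomposition I C (- a) (real m) d"
    by (auto simp: A_def)
  show ?thesis
  proof
    show "0 < (real n + real m) / r + 1"
      using \<open>0 < r\<close> by (simp add: add_nonneg_pos)
    fix x :: 'x assume x: "norm x \<le> 1"
    then have "a + r *\<^sub>R x \<in> closure (A n)"
      using \<open>0 < r\<close> r by (intro subsetD[OF r]) (simp add: dist_norm mult_left_le)
    then obtain y where y: "y \<in> A n" "dist y (a + r *\<^sub>R x) < r / 4"
      using \<open>0 < r\<close> unfolding closure_approachable by (meson zero_less_divide_iff zero_less_numeral)
    then obtain c where "cone_decomposition I C y (real n) c"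
      by (auto simp: A_def)
    then have "cone_decomposition I C ((1 / r) *\<^sub>R (y + - a)) ((1 / r) * (real n + real m)) (\<lambda>i. (1 / r) *\<^sub>R (c i + d i))"
      using d C \<open>0 < r\<close> by (intro cone_decomposition_scaleR cone_decomposition_add) auto
    then have "cone_decomposition I C ((1 / r) *\<^sub>R (y + - a)) ((real n + real m) / r + 1) (\<lambda>i. (1 / r) *\<^sub>R (c i + d i))"
      by (rule cone_decomposition_mono) simp
    moreover have "norm (x - (1 / r) *\<^sub>R (y + - a)) \<le> 1 / 4"
    proof -
      have "x - (1 / r) *\<^sub>R (y + - a) = (1 / r) *\<^sub>R ((a + r *\<^sub>R x) - y)"
        using \<open>0 < r\<close> by (simp add: algebra_simps)
      also have "norm \<dots> = norm (y - (a + r *\<^sub>R x)) / r"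
        using \<open>0 < r\<close> by (simp add: norm_minus_commute)
      also have "\<dots> \<le> 1 / 4"
        using \<open>0 < r\<close> y(2) by (simp add: dist_norm field_simps)
      finally show ?thesis .
    qed
    ultimately show "\<exists>y c. cone_decomposition I C y ((real n + real m) / r + 1) c \<and> norm (x - y) \<le> 1 / 4"
      by blast
  qed
qed

section \<open>Continuous homogeneous selections\<close>

text \<open>
  Averaging the chosen decompositions \<open>c a\<close> of vectors \<open>v a\<close> near \<open>sgn a\<close> with the weights \<open>h a x\<close>
  gives a decomposition of some \<open>q x\<close> that varies continuously with \<open>x\<close>. The weights sum to \<open>norm x\<close>
  and involve only \<open>v a\<close> within \<open>1 / 4 + 1 / 4\<close> of \<open>sgn x\<close>, which bounds the error by half the norm.
\<close>

lemma ex_approximate_selection: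
  fixes C :: "'i \<Rightarrow> 'x::banach set"
  assumes C: "\<And>i. i \<in> I \<Longrightarrow> additive_cone (C i)" "\<And>i. i \<in> I \<Longrightarrow> closed (C i)"
    and dec: "\<And>x. \<exists>c. (\<forall>i\<in>I. c i \<in> C i) \<and> c abs_summable_on I \<and> (c has_sum x) I"
  obtains M q g
  where "0 < M"
    and "\<And>x. cone_decomposition I C (q x) (M * norm x) (\<lambda>i. g i x)"
    and "\<And>x. norm (x - q x) \<le> norm x / 2"
    and "continuous_on UNIV q" and "\<And>i. i \<in> I \<Longrightarrow> continuous_on UNIV (g i)"
    and "\<And>t x. 0 \<le> t \<Longrightarrow> q (t *\<^sub>R x) = t *\<^sub>R q x"
    and "\<And>i t x. 0 \<le> t \<Longrightarrow> g i (t *\<^sub>R x) = t *\<^sub>R g i x"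
proof -
  obtain M where "0 < M"
    and M: "\<And>x::'x. norm x \<le> 1 \<Longrightarrow> \<exists>y c. cone_decomposition I C y M c \<and> norm (x - y) \<le> 1 / 4"
    using ex_uniform_approximate_decomposition[OF C(1) dec] by metis
  have "\<forall>a. \<exists>y c. cone_decomposition I C y M c \<and> norm (sgn a - y) \<le> 1 / 4" for a :: 'x
    using M by (simp add: norm_sgn)
  then obtain v c where v: "\<And>a. cone_decomposition I C (v a) M (c a)" "\<And>a. norm (sgn a - v a) \<le> 1 / 4"
    by metis
  obtain h :: "'x \<Rightarrow> 'x \<Rightarrow> real" where h: "\<And>a x. 0 \<le> h a x" "\<And>a. continuous_on UNIV (h a)"
      "\<And>x. ((\<lambda>a. h a x) has_sum norm x) UNIV"
      "\<And>a t x. 0 \<le> t \<Longrightarrow> h a (t *\<^sub>R x) = t * h a x"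
      "\<And>a x. h a x \<noteq> 0 \<Longrightarrow> norm (x - norm x *\<^sub>R sgn a) \<le> norm x / 4"
    using ex_partition_of_norm by blast
  have ne: "C i \<noteq> {}" if "i \<in> I" for i
    using v(1)[of 0] that by (auto simp: cone_decomposition_def)
  define q where "q x = (\<Sum>\<^sub>\<infinity>a. h a x *\<^sub>R v a)" for x
  define g where "g i x = (\<Sum>\<^sub>\<infinity>a. h a x *\<^sub>R c a i)" for i x
  have vM: "norm (v a) \<le> M" for a
    by (rule cone_decomposition_norm_sum_le[OF v(1)])
  have scale: "(\<Sum>\<^sub>\<infinity>a. h a (t *\<^sub>R x) *\<^sub>R w a) = t *\<^sub>R (\<Sum>\<^sub>\<infinity>a. h a x *\<^sub>R w a)"
    if "0 \<le> t" for t x and w :: "'x \<Rightarrow> 'x"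
  proof -
    have "(\<Sum>\<^sub>\<infinity>a. h a (t *\<^sub>R x) *\<^sub>R w a) = (\<Sum>\<^sub>\<infinity>a. t *\<^sub>R (h a x *\<^sub>R w a))"
      using h(4)[OF that] by simp
    then show ?thesis
      by (simp only: infsum_scaleR_right)
  qed
  show ?thesis
  proof
    show "0 < M"
      by fact
    show "cone_decomposition I C (q x) (M * norm x) (\<lambda>i. g i x)" for x
      unfolding q_def g_def
    proof (rule cone_decomposition_infsum[OF C _ ne])
      show "cone_decomposition I C (h a x *\<^sub>R v a) (h a x * M) (\<lambda>i. h a x *\<^sub>R c a i)" for a
        using v(1) h(1) C(1) by (intro cone_decomposition_scaleR)
      show "((\<lambda>a. h a x * M) has_sum M * norm x) UNIV"
        using has_sum_cmult_left[OF h(3), of x M] by (simp add: mult.commute)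
    qed
    show "norm (x - q x) \<le> norm x / 2" for x
    proof -
      have sx: "((\<lambda>a. h a x *\<^sub>R sgn x) has_sum norm x *\<^sub>R sgn x) UNIV"
        using h(3)[of x] has_sum_bounded_linear[OF bounded_linear_scaleR_left] by blast
      have abs: "(\<lambda>a. h a x *\<^sub>R v a) abs_summable_on UNIV"
        using h(1) vM summable_on_cmult_left[OF has_sum_imp_summable[OF h(3)[of x]], of M]
        by (intro Infinite_Sum.abs_summable_on_comparison_test'[where g = "\<lambda>a. h a x * M"])
          (auto intro!: mult_left_mono)
      have diff: "((\<lambda>a. h a x *\<^sub>R (sgn x - v a)) has_sum (norm x *\<^sub>R sgn x - q x)) UNIV"
        using has_sum_add[OF sx has_sum_scaleR[where c = "-1", OF has_sum_infsum[OF abs_summable_summable[OF abs]]]]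
        by (simp add: q_def scaleR_diff_right)
      have le: "norm (h a x *\<^sub>R (sgn x - v a)) \<le> h a x * (1 / 2)" for a
      proof (cases "h a x = 0")
        case False
        then have "norm (x - norm x *\<^sub>R sgn a) \<le> norm x / 4"
          by (rule h(5))
        have "x \<noteq> 0"
          using False h(4)[of 0 a x] by auto
        have "norm x * norm (sgn x - sgn a) = norm (x - norm x *\<^sub>R sgn a)"
          using \<open>x \<noteq> 0\<close> norm_scaleR[of "norm x" "sgn x - sgn a"]
          by (simp add: scaleR_diff_right sgn_div_norm)
        then have "norm x * norm (sgn x - sgn a) \<le> norm x * (1 / 4)"
          using \<open>norm (x - norm x *\<^sub>R sgn a) \<le> norm x / 4\<close> by simp
        then have "norm (sgn x - sgn a) \<le> 1 / 4"
          using \<open>x \<noteq> 0\<close> by (subst (asm) mult_le_cancel_left_pos) auto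
        moreover have "sgn x - v a = (sgn x - sgn a) + (sgn a - v a)"
          by simp
        ultimately have "norm (sgn x - v a) \<le> 1 / 2"
          using v(2)[of a] norm_triangle_ineq[of "sgn x - sgn a" "sgn a - v a"] by simp
        then show ?thesis
          using h(1)[of a x] mult_left_mono by fastforce
      qed simp
      have half: "((\<lambda>a. h a x * (1 / 2)) has_sum norm x * (1 / 2)) UNIV"
        by (intro has_sum_cmult_left h(3))
      have "(\<lambda>a. h a x *\<^sub>R (sgn x - v a)) abs_summable_on UNIV"
        using le by (intro Infinite_Sum.abs_summable_on_comparison_test'[OF has_sum_imp_summable[OF half]])
      then have nsum: "((\<lambda>a. norm (h a x *\<^sub>R (sgn x - v a))) has_sum
          (\<Sum>\<^sub>\<infinity>a. norm (h a x *\<^sub>R (sgn x - v a)))) UNIV"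
        by (rule has_sum_infsum)
      have "norm (norm x *\<^sub>R sgn x - q x) \<le> norm x * (1 / 2)"
        using norm_has_sum_bound[OF nsum diff] has_sum_mono[OF nsum half le] by linarith
      then show ?thesis
        by (cases "x = 0") (simp_all add: sgn_div_norm)
    qed
    show "continuous_on UNIV q"
      unfolding q_def by (rule continuous_on_infsum_scaleR[OF h(1,2,3) _ vM]) (intro continuous_intros)
    show "continuous_on UNIV (g i)" if "i \<in> I" for i
      unfolding g_def
      by (rule continuous_on_infsum_scaleR[OF h(1,2,3) _ cone_decomposition_norm_le[OF v(1) that]])
        (intro continuous_intros)
  qed (simp_all add: q_def g_def scale)
qed

text \<open>
  Applying the approximate selection to \<open>x\<close>, then to the error \<open>\<rho> 1 x = x - q x\<close>, then to the error of that, and so on, one gets errors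
  \<open>\<rho> k x\<close> that at least halve in every step. The vectors \<open>q (\<rho> k x)\<close> are differences of consecutive
  errors, so they telescope to \<open>x\<close>, and the decompositions sum to one of \<open>x\<close>. The geometric
  bound makes the series uniformly convergent on balls, which preserves continuity, and homogeneity
  passes through every step.
\<close>

lemma ex_continuous_homogeneous_selection:
  fixes C :: "'i \<Rightarrow> 'x::banach set"
  assumes C: "\<And>i. i \<in> I \<Longrightarrow> additive_cone (C i)" "\<And>i. i \<in> I \<Longrightarrow> closed (C i)"
    and dec: "\<And>x. \<exists>c. (\<forall>i\<in>I. c i \<in> C i) \<and> c abs_summable_on I \<and> (c has_sum x) I"
  obtains K \<gamma>
  where "0 < K"
    and "\<And>x. cone_decomposition I C x (K * norm x) (\<lambda>i. \<gamma> i x)"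
    and "\<And>i. i \<in> I \<Longrightarrow> continuous_on UNIV (\<gamma> i)"
    and "\<And>i t x. 0 \<le> t \<Longrightarrow> \<gamma> i (t *\<^sub>R x) = t *\<^sub>R \<gamma> i x"
proof -
  obtain M q g where "0 < M"
    and g: "\<And>x. cone_decomposition I C (q x) (M * norm x) (\<lambda>i. g i x)"
    and half: "\<And>x. norm (x - q x) \<le> norm x / 2"
    and cont: "continuous_on UNIV q" "\<And>i. i \<in> I \<Longrightarrow> continuous_on UNIV (g i)"
    and scale: "\<And>t x. 0 \<le> t \<Longrightarrow> q (t *\<^sub>R x) = t *\<^sub>R q x"
      "\<And>i t x. 0 \<le> t \<Longrightarrow> g i (t *\<^sub>R x) = t *\<^sub>R g i x"
    by (rule ex_approximate_selection[of I C, OF C dec]) (assumption | rule that)+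
  define \<rho> where "\<rho> k = ((\<lambda>x. x - q x) ^^ k)" for k
  have \<rho>_0: "\<rho> 0 x = x" and \<rho>_Suc: "\<rho> (Suc k) x = \<rho> k x - q (\<rho> k x)" for k x
    by (simp_all add: \<rho>_def)
  have \<rho>_cont: "continuous_on UNIV (\<rho> k)" for k
  proof (induction k)
    case (Suc k)
    then have "continuous_on UNIV (\<lambda>x. \<rho> k x - q (\<rho> k x))"
      using cont(1) by (intro continuous_intros) (auto intro: continuous_on_compose2)
    then show ?case
      by (simp add: \<rho>_Suc[abs_def])
  qed (simp add: \<rho>_def)
  have \<rho>_scale: "\<rho> k (t *\<^sub>R x) = t *\<^sub>R \<rho> k x" if "0 \<le> t" for k t x
    by (induction k) (simp_all add: \<rho>_0 \<rho>_Suc scale(1)[OF that] scaleR_diff_right)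
  have \<rho>_le: "norm (\<rho> k x) \<le> norm x * (1 / 2) ^ k" for k x
  proof (induction k)
    case (Suc k)
    then show ?case
      using half[of "\<rho> k x"] by (simp add: \<rho>_Suc)
  qed (simp add: \<rho>_0)
  have geom: "((\<lambda>k. B * (1 / 2) ^ k) has_sum B * 2) (UNIV :: nat set)" if "0 \<le> B" for B :: real
    using geometric_sums[of "1 / 2 :: real"] that
    by (intro has_sum_cmult_right sums_nonneg_imp_has_sum) auto
  define \<gamma> where "\<gamma> i x = (\<Sum>\<^sub>\<infinity>k. g i (\<rho> k x))" for i x
  have g_le: "cone_decomposition I C (q (\<rho> k x)) (M * norm x * (1 / 2) ^ k) (\<lambda>i. g i (\<rho> k x))" for k x
    using \<rho>_le[of k x] \<open>0 < M\<close>
    by (intro cone_decomposition_mono[OF g]) (simp add: mult_le_cancel_left mult.assoc)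
  have ne: "C i \<noteq> {}" if "i \<in> I" for i
    using g that by (fastforce simp: cone_decomposition_def)
  show ?thesis
  proof
    show "0 < M * 2"
      using \<open>0 < M\<close> by simp
    show "cone_decomposition I C x (M * 2 * norm x) (\<lambda>i. \<gamma> i x)" for x
    proof -
      have "(\<lambda>k. q (\<rho> k x)) sums x"
      proof -
        have "(\<lambda>k. \<rho> k x) \<longlonglongrightarrow> 0"
        proof (rule Lim_null_comparison)
          show "\<forall>\<^sub>F k in sequentially. norm (\<rho> k x) \<le> norm x * (1 / 2) ^ k"
            using \<rho>_le by simp
          show "(\<lambda>k. norm x * (1 / 2) ^ k) \<longlonglongrightarrow> 0"
            by (intro tendsto_mult_right_zero LIMSEQ_realpow_zero) auto
        qed
        then have "(\<lambda>k. \<rho> k x - \<rho> (Suc k) x) sums (\<rho> 0 x - 0)"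
          by (rule telescope_sums')
        then show ?thesis
          by (simp add: \<rho>_Suc \<rho>_0)
      qed
      moreover have "summable (\<lambda>k. norm (q (\<rho> k x)))"
        using has_sum_imp_summable[OF geom[of "M * norm x"]] \<open>0 < M\<close> cone_decomposition_norm_sum_le[OF g_le]
        by (intro summable_comparison_test'[OF summable_on_imp_summable]) auto
      ultimately have "(\<Sum>\<^sub>\<infinity>k. q (\<rho> k x)) = x"
        by (intro infsumI norm_summable_imp_has_sum)
      moreover have "cone_decomposition I C (\<Sum>\<^sub>\<infinity>k. q (\<rho> k x)) (M * norm x * 2) (\<lambda>i. \<gamma> i x)"
        unfolding \<gamma>_def using \<open>0 < M\<close> by (intro cone_decomposition_infsum[OF C g_le ne] geom) auto
      ultimately show ?thesis
        by (simp add: mult_ac)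
    qed
    show "\<gamma> i (t *\<^sub>R x) = t *\<^sub>R \<gamma> i x" if "0 \<le> t" for i t x
      by (simp add: \<gamma>_def \<rho>_scale[OF that] scale(2)[OF that] infsum_scaleR_right)
    show "continuous_on UNIV (\<gamma> i)" if "i \<in> I" for i
    proof -
      have "continuous_on (ball 0 R) (\<gamma> i)" for R
        unfolding \<gamma>_def
      proof (rule uniform_limit_theorem)
        have "norm (g i (\<rho> k x)) \<le> M * \<bar>R\<bar> * (1 / 2) ^ k" if "x \<in> ball 0 R" for k x
        proof -
          have "norm (g i (\<rho> k x)) \<le> M * norm x * (1 / 2) ^ k"
            by (rule cone_decomposition_norm_le[OF g_le \<open>i \<in> I\<close>])
          also have "\<dots> \<le> M * \<bar>R\<bar> * (1 / 2) ^ k"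
            using that \<open>0 < M\<close> by (intro mult_right_mono mult_left_mono) auto
          finally show ?thesis .
        qed
        then show "uniform_limit (ball 0 R) (\<lambda>X x. \<Sum>k\<in>X. g i (\<rho> k x)) (\<lambda>x. \<Sum>\<^sub>\<infinity>k. g i (\<rho> k x))
            (finite_subsets_at_top UNIV)"
          using geom[of "M * \<bar>R\<bar>"] \<open>0 < M\<close>
          by (intro Weierstrass_m_test_general[where M = "\<lambda>k. M * \<bar>R\<bar> * (1 / 2) ^ k"])
            (auto intro: has_sum_imp_summable)
        have "continuous_on (ball 0 R) (\<lambda>x. g i (\<rho> k x))" for k
          using continuous_on_compose2[OF cont(2)[OF that] \<rho>_cont] continuous_on_subset by blast
        then show "\<forall>\<^sub>F X in finite_subsets_at_top UNIV. continuous_on (ball 0 R) (\<lambda>x. \<Sum>k\<in>X. g i (\<rho> k x))"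
          by (intro always_eventually allI continuous_on_sum)
      qed simp
      then have "continuous_on (\<Union>R. ball 0 R) (\<gamma> i)"
        by (intro continuous_on_open_UN) auto
      moreover have "(\<Union>R. ball (0::'x) R) = UNIV"
        using gt_ex by (auto simp: set_eq_iff)
      ultimately show ?thesis
        by simp
    qed
  qed
qed

section \<open>Spaces of continuous functions\<close>

lemma cont_funs_iff:
  "f \<in> cont_funs \<Omega> S \<longleftrightarrow> f \<in> extensional (topspace \<Omega>) \<and> continuous_map \<Omega> euclidean f \<and>
     (\<forall>\<omega>\<in>topspace \<Omega>. f \<omega> \<in> S)"
  by (auto simp: cont_funs_def continuous_map_in_subtopology)

lemma cont_funs_add:
  assumes "additive_cone S" "f \<in> cont_funs \<Omega> S" "g \<in> cont_funs \<Omega> S"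
  shows "(\<lambda>\<omega>\<in>topspace \<Omega>. f \<omega> + g \<omega>) \<in> cont_funs \<Omega> S"
proof -
  have "continuous_map \<Omega> euclidean (\<lambda>\<omega>. f \<omega> + g \<omega>)"
    using assms by (intro continuous_intros) (auto simp: cont_funs_iff)
  then show ?thesis
    using assms by (auto simp: cont_funs_iff additive_cone_add intro: continuous_map_eq)
qed

lemma cont_funs_scaleR:
  assumes "additive_cone S" "f \<in> cont_funs \<Omega> S" "0 \<le> r"
  shows "(\<lambda>\<omega>\<in>topspace \<Omega>. r *\<^sub>R f \<omega>) \<in> cont_funs \<Omega> S"
proof -
  have "continuous_map \<Omega> euclidean ((\<lambda>x. r *\<^sub>R x) \<circ> f)"
    using assms(2) by (intro continuous_map_compose[of \<Omega> euclidean])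
      (auto simp: cont_funs_iff intro!: continuous_intros)
  then show ?thesis
    using assms by (auto simp: cont_funs_iff additive_cone_scaleR o_def intro: continuous_map_eq)
qed

lemma additive_cone_UNIV: "additive_cone UNIV"
  by (simp add: additive_cone_def)

lemma compactin_norm_ge_subset:
  fixes g :: "'a \<Rightarrow> 'x::real_normed_vector"
  assumes "continuous_map \<Omega> euclidean g" "compactin \<Omega> K"
    and "{\<omega> \<in> topspace \<Omega>. norm (g \<omega>) \<ge> \<epsilon>} \<subseteq> K"
  shows "compactin \<Omega> {\<omega> \<in> topspace \<Omega>. norm (g \<omega>) \<ge> \<epsilon>}"
proof (rule closed_compactin[OF assms(2,3)])
  have "closed {x::'x. norm x \<ge> \<epsilon>}"
    by (intro closed_Collect_le continuous_intros)
  then show "closedin \<Omega> {\<omega> \<in> topspace \<Omega>. norm (g \<omega>) \<ge> \<epsilon>}"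
    using closedin_continuous_map_preimage[OF assms(1), of "{x. norm x \<ge> \<epsilon>}"] by simp
qed

text \<open>
  \<open>K\<close> is required to be positive, and not only nonnegative, so that \<open>\<epsilon> / K\<close> makes sense for
  functions vanishing at infinity.
\<close>

definition dominated_by :: "'a topology \<Rightarrow> real \<Rightarrow> ('a \<Rightarrow> 'x::real_normed_vector) \<Rightarrow> ('a \<Rightarrow> 'x) \<Rightarrow> bool" where
  "dominated_by \<Omega> K f g \<longleftrightarrow> 0 < K \<and> (\<forall>\<omega>\<in>topspace \<Omega>. norm (g \<omega>) \<le> K * norm (f \<omega>))"

text \<open>
  The properties that cut out the four function spaces are all stable under domination and under
  sums. Nothing else is used to show that the decomposition of a function in one of the spaces stays
  in that space and that the functions with values in a cone form a cone.
\<close>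

definition solid_class :: "'a topology \<Rightarrow> (('a \<Rightarrow> 'x::real_normed_vector) \<Rightarrow> bool) \<Rightarrow> bool" where
  "solid_class \<Omega> P \<longleftrightarrow>
     (\<forall>f\<in>cont_funs \<Omega> UNIV. \<forall>g\<in>cont_funs \<Omega> UNIV. \<forall>K. P f \<longrightarrow> dominated_by \<Omega> K f g \<longrightarrow> P g) \<and>
     (\<forall>f\<in>cont_funs \<Omega> UNIV. \<forall>g\<in>cont_funs \<Omega> UNIV. P f \<longrightarrow> P g \<longrightarrow> P (\<lambda>\<omega>\<in>topspace \<Omega>. f \<omega> + g \<omega>))"

lemma sup_norm_dominated:
  assumes "dominated_by \<Omega> K f g"
  shows "sup_norm \<Omega> g \<le> ennreal K * sup_norm \<Omega> f"
  unfolding sup_norm_def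
proof (rule SUP_least)
  fix \<omega> assume \<omega>: "\<omega> \<in> topspace \<Omega>"
  have "ennreal (norm (g \<omega>)) \<le> ennreal K * ennreal (norm (f \<omega>))"
    using assms \<omega> by (simp add: dominated_by_def ennreal_mult'[symmetric] ennreal_leI)
  also have "\<dots> \<le> ennreal K * (SUP \<omega>\<in>topspace \<Omega>. ennreal (norm (f \<omega>)))"
    using \<omega> by (intro mult_left_mono SUP_upper) auto
  finally show "ennreal (norm (g \<omega>)) \<le> ennreal K * (SUP \<omega>\<in>topspace \<Omega>. ennreal (norm (f \<omega>)))" .
qed

lemma fun_support_dominated:
  assumes "dominated_by \<Omega> K f g"
  shows "fun_support \<Omega> g \<subseteq> fun_support \<Omega> f"
  unfolding fun_support_def using assms
  by (intro closure_of_mono) (force simp: dominated_by_def)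

lemma solid_class_True: "solid_class \<Omega> (\<lambda>f. True)"
  by (simp add: solid_class_def)

lemma solid_class_bounded: "solid_class \<Omega> (\<lambda>f. bounded (f ` topspace \<Omega>))"
  unfolding solid_class_def
proof (intro conjI ballI allI impI)
  fix f g :: "'a \<Rightarrow> 'b" and K :: real
  assume "bounded (f ` topspace \<Omega>)" "dominated_by \<Omega> K f g"
  then obtain B where "\<And>\<omega>. \<omega> \<in> topspace \<Omega> \<Longrightarrow> norm (f \<omega>) \<le> B"
    by (auto simp: bounded_iff)
  then have "norm (g \<omega>) \<le> K * B" if "\<omega> \<in> topspace \<Omega>" for \<omega>
    using that \<open>dominated_by \<Omega> K f g\<close> unfolding dominated_by_def
    by (meson less_imp_le mult_left_mono order_trans)
  then show "bounded (g ` topspace \<Omega>)"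
    by (auto simp: bounded_iff)
next
  fix f g :: "'a \<Rightarrow> 'b"
  assume "bounded (f ` topspace \<Omega>)" "bounded (g ` topspace \<Omega>)"
  then obtain B D where "\<And>\<omega>. \<omega> \<in> topspace \<Omega> \<Longrightarrow> norm (f \<omega>) \<le> B" "\<And>\<omega>. \<omega> \<in> topspace \<Omega> \<Longrightarrow> norm (g \<omega>) \<le> D"
    unfolding bounded_iff by blast
  then have "norm (f \<omega> + g \<omega>) \<le> B + D" if "\<omega> \<in> topspace \<Omega>" for \<omega>
    using that by (meson norm_triangle_mono)
  then show "bounded ((\<lambda>\<omega>\<in>topspace \<Omega>. f \<omega> + g \<omega>) ` topspace \<Omega>)"
    by (auto simp: bounded_iff)
qed

lemma solid_class_vanishes_at_infinity: "solid_class \<Omega> (vanishes_at_infinity \<Omega>)"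
  unfolding solid_class_def
proof (intro conjI ballI allI impI)
  fix f g :: "'a \<Rightarrow> 'b" and K :: real
  assume g: "g \<in> cont_funs \<Omega> UNIV" and f: "vanishes_at_infinity \<Omega> f" and K: "dominated_by \<Omega> K f g"
  show "vanishes_at_infinity \<Omega> g"
    unfolding vanishes_at_infinity_def
  proof (intro allI impI)
    fix \<epsilon> :: real assume "0 < \<epsilon>"
    have "0 < K"
      using K by (simp add: dominated_by_def)
    show "compactin \<Omega> {\<omega> \<in> topspace \<Omega>. \<epsilon> \<le> norm (g \<omega>)}"
    proof (rule compactin_norm_ge_subset)
      show "compactin \<Omega> {\<omega> \<in> topspace \<Omega>. \<epsilon> / K \<le> norm (f \<omega>)}"
        using f \<open>0 < \<epsilon>\<close> \<open>0 < K\<close> by (simp add: vanishes_at_infinity_def)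
      show "{\<omega> \<in> topspace \<Omega>. \<epsilon> \<le> norm (g \<omega>)} \<subseteq> {\<omega> \<in> topspace \<Omega>. \<epsilon> / K \<le> norm (f \<omega>)}"
        using K \<open>0 < K\<close> by (force simp: dominated_by_def field_simps)
    qed (use g in \<open>simp add: cont_funs_iff\<close>)
  qed
next
  fix f g :: "'a \<Rightarrow> 'b"
  assume fg: "f \<in> cont_funs \<Omega> UNIV" "g \<in> cont_funs \<Omega> UNIV"
    and v: "vanishes_at_infinity \<Omega> f" "vanishes_at_infinity \<Omega> g"
  let ?s = "\<lambda>\<omega>\<in>topspace \<Omega>. f \<omega> + g \<omega>"
  show "vanishes_at_infinity \<Omega> ?s"
    unfolding vanishes_at_infinity_def
  proof (intro allI impI)
    fix \<epsilon> :: real assume "0 < \<epsilon>"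
    show "compactin \<Omega> {\<omega> \<in> topspace \<Omega>. \<epsilon> \<le> norm (?s \<omega>)}"
    proof (rule compactin_norm_ge_subset)
      show "continuous_map \<Omega> euclidean ?s"
        using cont_funs_add[OF additive_cone_UNIV fg] by (simp add: cont_funs_iff)
      show "compactin \<Omega> ({\<omega> \<in> topspace \<Omega>. \<epsilon> / 2 \<le> norm (f \<omega>)} \<union> {\<omega> \<in> topspace \<Omega>. \<epsilon> / 2 \<le> norm (g \<omega>)})"
        using v half_gt_zero[OF \<open>0 < \<epsilon>\<close>] unfolding vanishes_at_infinity_def
        by (intro compactin_Un) blast+
      show "{\<omega> \<in> topspace \<Omega>. \<epsilon> \<le> norm (?s \<omega>)} \<subseteq>
          {\<omega> \<in> topspace \<Omega>. \<epsilon> / 2 \<le> norm (f \<omega>)} \<union> {\<omega> \<in> topspace \<Omega>. \<epsilon> / 2 \<le> norm (g \<omega>)}"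
      proof
        fix \<omega> assume "\<omega> \<in> {\<omega> \<in> topspace \<Omega>. \<epsilon> \<le> norm (?s \<omega>)}"
        then have "\<omega> \<in> topspace \<Omega>" "\<epsilon> \<le> norm (?s \<omega>)"
          by blast+
        then have "\<epsilon> \<le> norm (f \<omega> + g \<omega>)"
          by simp
        then have "\<epsilon> / 2 \<le> norm (f \<omega>) \<or> \<epsilon> / 2 \<le> norm (g \<omega>)"
          using norm_triangle_ineq[of "f \<omega>" "g \<omega>"] by linarith
        with \<open>\<omega> \<in> topspace \<Omega>\<close> show "\<omega> \<in> {\<omega> \<in> topspace \<Omega>. \<epsilon> / 2 \<le> norm (f \<omega>)} \<union> {\<omega> \<in> topspace \<Omega>. \<epsilon> / 2 \<le> norm (g \<omega>)}"
          by simp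
      qed
    qed
  qed
qed

lemma solid_class_compact_support: "solid_class \<Omega> (\<lambda>f. compactin \<Omega> (fun_support \<Omega> f))"
  unfolding solid_class_def
proof (intro conjI ballI allI impI)
  fix f g :: "'a \<Rightarrow> 'b" and K :: real
  assume f: "compactin \<Omega> (fun_support \<Omega> f)" and "dominated_by \<Omega> K f g"
  then show "compactin \<Omega> (fun_support \<Omega> g)"
    by (intro closed_compactin[OF f fun_support_dominated]) (auto simp: fun_support_def)
next
  fix f g :: "'a \<Rightarrow> 'b"
  assume fg: "compactin \<Omega> (fun_support \<Omega> f)" "compactin \<Omega> (fun_support \<Omega> g)"
  show "compactin \<Omega> (fun_support \<Omega> (\<lambda>\<omega>\<in>topspace \<Omega>. f \<omega> + g \<omega>))"
  proof (rule closed_compactin[OF compactin_Un[OF fg]])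
    show "fun_support \<Omega> (\<lambda>\<omega>\<in>topspace \<Omega>. f \<omega> + g \<omega>) \<subseteq> fun_support \<Omega> f \<union> fun_support \<Omega> g"
      unfolding fun_support_def closure_of_Un[symmetric] by (intro closure_of_mono) auto
  qed (simp add: fun_support_def)
qed

lemma fun_cone_solid_class:
  assumes "additive_cone S" and P: "solid_class \<Omega> P"
  shows "fun_cone \<Omega> {f \<in> cont_funs \<Omega> S. P f}"
proof -
  have U: "f \<in> cont_funs \<Omega> UNIV" if "f \<in> cont_funs \<Omega> S" for f
    using that by (simp add: cont_funs_iff)
  have add: "P (\<lambda>\<omega>\<in>topspace \<Omega>. f \<omega> + g \<omega>)"
    if "f \<in> cont_funs \<Omega> S" "g \<in> cont_funs \<Omega> S" "P f" "P g" for f g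
    using P U that unfolding solid_class_def by blast
  have "P (\<lambda>\<omega>\<in>topspace \<Omega>. r *\<^sub>R f \<omega>)" if "f \<in> cont_funs \<Omega> S" "P f" "0 \<le> r" for f r
  proof -
    have "dominated_by \<Omega> (r + 1) f (\<lambda>\<omega>\<in>topspace \<Omega>. r *\<^sub>R f \<omega>)"
      using \<open>0 \<le> r\<close> by (auto simp: dominated_by_def mult_right_mono)
    then show ?thesis
      using P U[OF that(1)] U[OF cont_funs_scaleR[OF assms(1) that(1,3)]] that(2)
      unfolding solid_class_def by blast
  qed
  then show ?thesis
    using assms(1) add by (auto simp: fun_cone_def cont_funs_add cont_funs_scaleR)
qed

text \<open>
  The nonemptiness of \<open>I\<close> matters: an empty sum is the zero function, which is not known to
  satisfy \<open>P\<close> unless some function does.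
\<close>

lemma cont_funs_solid_class_eq_fun_sum:
  assumes "finite I" "I \<noteq> {}" and P: "solid_class \<Omega> P"
    and F: "\<And>f. f \<in> cont_funs \<Omega> UNIV \<Longrightarrow> \<exists>F K. (\<forall>i\<in>I. F i \<in> cont_funs \<Omega> (C i) \<and> dominated_by \<Omega> K f (F i)) \<and>
        (\<forall>\<omega>\<in>topspace \<Omega>. f \<omega> = (\<Sum>i\<in>I. F i \<omega>))"
  shows "{f \<in> cont_funs \<Omega> UNIV. P f} = fun_sum \<Omega> I (\<lambda>i. {f \<in> cont_funs \<Omega> (C i). P f})"
proof (intro equalityI subsetI)
  fix f assume "f \<in> {f \<in> cont_funs \<Omega> UNIV. P f}"
  then have f: "f \<in> cont_funs \<Omega> UNIV" "P f"
    by auto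
  obtain F K where F: "\<And>i. i \<in> I \<Longrightarrow> F i \<in> cont_funs \<Omega> (C i)" "\<And>i. i \<in> I \<Longrightarrow> dominated_by \<Omega> K f (F i)"
    "\<And>\<omega>. \<omega> \<in> topspace \<Omega> \<Longrightarrow> f \<omega> = (\<Sum>i\<in>I. F i \<omega>)"
    using F[OF f(1)] by blast
  have "P (F i)" if "i \<in> I" for i
  proof -
    have "F i \<in> cont_funs \<Omega> UNIV"
      using F(1)[OF that] by (simp add: cont_funs_iff)
    then show ?thesis
      using P f F(2)[OF that] unfolding solid_class_def by blast
  qed
  moreover have "f = (\<lambda>\<omega>\<in>topspace \<Omega>. \<Sum>i\<in>I. F i \<omega>)"
    using f(1) F(3) by (intro extensionalityI[of _ "topspace \<Omega>"]) (auto simp: cont_funs_iff)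
  ultimately show "f \<in> fun_sum \<Omega> I (\<lambda>i. {f \<in> cont_funs \<Omega> (C i). P f})"
    using F(1) unfolding fun_sum_def by blast
next
  fix f assume "f \<in> fun_sum \<Omega> I (\<lambda>i. {f \<in> cont_funs \<Omega> (C i). P f})"
  then obtain g where f: "f = (\<lambda>\<omega>\<in>topspace \<Omega>. \<Sum>i\<in>I. g i \<omega>)"
    and g: "\<And>i. i \<in> I \<Longrightarrow> g i \<in> cont_funs \<Omega> UNIV" "\<And>i. i \<in> I \<Longrightarrow> P (g i)"
    unfolding fun_sum_def by (auto simp: cont_funs_iff)
  have "(\<lambda>\<omega>\<in>topspace \<Omega>. \<Sum>i\<in>J. g i \<omega>) \<in> {f \<in> cont_funs \<Omega> UNIV. P f}"
    if "finite J" "J \<noteq> {}" "J \<subseteq> I" for J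
    using that
  proof (induction J rule: finite_ne_induct)
    case (singleton i)
    then have "(\<lambda>\<omega>\<in>topspace \<Omega>. g i \<omega>) = g i"
      using g(1)[of i] by (simp add: cont_funs_iff extensional_restrict)
    then show ?case
      using singleton g by simp
  next
    case (insert i J)
    let ?s = "\<lambda>\<omega>\<in>topspace \<Omega>. \<Sum>i\<in>J. g i \<omega>"
    have "(\<lambda>\<omega>\<in>topspace \<Omega>. g i \<omega> + ?s \<omega>) \<in> {f \<in> cont_funs \<Omega> UNIV. P f}"
      using insert g fun_cone_solid_class[OF additive_cone_UNIV P] unfolding fun_cone_def by blast
    moreover have "(\<lambda>\<omega>\<in>topspace \<Omega>. g i \<omega> + ?s \<omega>) = (\<lambda>\<omega>\<in>topspace \<Omega>. \<Sum>i\<in>insert i J. g i \<omega>)"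
      using insert.hyps by (intro restrict_ext) simp
    ultimately show ?case
      by metis
  qed
  then show "f \<in> {f \<in> cont_funs \<Omega> UNIV. P f}"
    using assms(1,2) f by blast
qed

text \<open>
  Convergence in the sup-norm implies pointwise convergence, and \<open>S\<close> is closed.
\<close>

lemma closedin_sup_norm_topology_valued:
  fixes S :: "'x::real_normed_vector set"
  assumes "closed S"
  shows "closedin (sup_norm_topology \<Omega>) {f \<in> cont_b_funs \<Omega> UNIV. \<forall>\<omega>\<in>topspace \<Omega>. f \<omega> \<in> S}"
    (is "closedin _ ?F")
proof -
  let ?m = "cfunspace \<Omega> (euclidean_metric :: 'x metric)"
  interpret M: Metric_space "mspace ?m" "mdist ?m"
    by (rule Metric_space_mspace_mdist)
  have space: "mspace ?m = cont_b_funs \<Omega> UNIV"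
    using topspace_sup_norm_topology[of \<Omega>, where 'b = 'x] by (simp add: sup_norm_topology_def)
  have "\<exists>r>0. disjnt ?F (M.mball f r)" if f: "f \<in> mspace ?m - ?F" for f
  proof -
    obtain \<omega> where \<omega>: "\<omega> \<in> topspace \<Omega>" "f \<omega> \<in> - S"
      using f space by blast
    then obtain r where "0 < r" and r: "ball (f \<omega>) r \<subseteq> - S"
      using assms open_contains_ball by (metis open_Compl)
    have "g \<notin> ?F" if "g \<in> M.mball f r" for g
    proof -
      have g: "g \<in> mspace ?m" "f \<in> mspace ?m" "mdist ?m f g < r"
        using that unfolding M.in_mball by blast+
      have "dist (f \<omega>) (g \<omega>) \<le> mdist ?m f g"
        using mdist_cfunspace_imp_mdist_le[OF g(2,1) order_refl \<omega>(1)] by simp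
      then have "g \<omega> \<in> - S"
        using r g(3) by (meson le_less_trans mem_ball subsetD)
      then show ?thesis
        using \<omega>(1) by auto
    qed
    then show ?thesis
      using \<open>0 < r\<close> by (auto simp: disjnt_iff)
  qed
  then show ?thesis
    unfolding sup_norm_topology_def mtopology_of_def M.closedin_metric using space by auto
qed

lemma closed_in_normed_solid_class:
  assumes "closed S" and "V = {f \<in> cont_funs \<Omega> UNIV. P f}" and "V \<subseteq> cont_b_funs \<Omega> UNIV"
  shows "closed_in_normed \<Omega> V {f \<in> cont_funs \<Omega> S. P f}"
proof -
  have "{f \<in> cont_funs \<Omega> S. P f} = V \<inter> {f \<in> cont_b_funs \<Omega> UNIV. \<forall>\<omega>\<in>topspace \<Omega>. f \<omega> \<in> S}"
    using assms(2,3) by (auto simp: cont_funs_iff)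
  then show ?thesis
    using closedin_sup_norm_topology_valued[OF assms(1), of \<Omega>]
    by (simp add: closed_in_normed_def closedin_subtopology_Int_closed)
qed

section \<open>Decomposing continuous functions along cones\<close>

theorem theorem4p5:
  fixes I :: "'i set" and C :: "'i \<Rightarrow> 'x::banach set" and \<Omega> :: "'a topology"
  assumes "I \<noteq> {}"
    and "\<And>i. i \<in> I \<Longrightarrow> closed (C i)"
    and "\<And>i. i \<in> I \<Longrightarrow> additive_cone (C i)"
    and "\<And>x. \<exists>c. (\<forall>i\<in>I. c i \<in> C i) \<and> c abs_summable_on I \<and> (c has_sum x) I"
  shows "(\<exists>K>0. \<forall>f\<in>cont_funs \<Omega> UNIV. \<exists>F. (\<forall>i\<in>I. F i \<in> cont_funs \<Omega> (C i)) \<and>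
            (\<forall>\<omega>\<in>topspace \<Omega>. ((\<lambda>i. F i \<omega>) has_sum f \<omega>) I \<and>
               (\<lambda>i. F i \<omega>) abs_summable_on I \<and>
               (\<Sum>\<^sub>\<infinity>i\<in>I. norm (F i \<omega>)) \<le> K * norm (f \<omega>)) \<and>
            (\<forall>i\<in>I. sup_norm \<Omega> (F i) \<le> ennreal K * sup_norm \<Omega> f) \<and>
            (\<forall>i\<in>I. fun_support \<Omega> (F i) \<subseteq> fun_support \<Omega> f) \<and>
            (vanishes_at_infinity \<Omega> f \<longrightarrow> (\<forall>i\<in>I. vanishes_at_infinity \<Omega> (F i))) \<and>
            (\<forall>\<omega>1\<in>topspace \<Omega>. \<forall>\<omega>2\<in>topspace \<Omega>. \<forall>r1\<ge>0. \<forall>r2\<ge>0.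
               r1 *\<^sub>R f \<omega>1 = r2 *\<^sub>R f \<omega>2 \<longrightarrow> (\<forall>i\<in>I. r1 *\<^sub>R F i \<omega>1 = r2 *\<^sub>R F i \<omega>2))) \<and>
         (finite I \<longrightarrow>
            (UNIV :: 'x set) = (\<Sum>i\<in>I. C i) \<and>
            cont_funs \<Omega> UNIV = fun_sum \<Omega> I (\<lambda>i. cont_funs \<Omega> (C i)) \<and>
            cont_b_funs \<Omega> UNIV = fun_sum \<Omega> I (\<lambda>i. cont_b_funs \<Omega> (C i)) \<and>
            cont_0_funs \<Omega> UNIV = fun_sum \<Omega> I (\<lambda>i. cont_0_funs \<Omega> (C i)) \<and>
            cont_c_funs \<Omega> UNIV = fun_sum \<Omega> I (\<lambda>i. cont_c_funs \<Omega> (C i)) \<and>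
            (\<forall>i\<in>I. fun_cone \<Omega> (cont_funs \<Omega> (C i)) \<and>
                   fun_cone \<Omega> (cont_b_funs \<Omega> (C i)) \<and>
                   fun_cone \<Omega> (cont_0_funs \<Omega> (C i)) \<and>
                   fun_cone \<Omega> (cont_c_funs \<Omega> (C i)) \<and>
                   closed_in_normed \<Omega> (cont_b_funs \<Omega> UNIV) (cont_b_funs \<Omega> (C i)) \<and>
                   closed_in_normed \<Omega> (cont_0_funs \<Omega> UNIV) (cont_0_funs \<Omega> (C i)) \<and>
                   closed_in_normed \<Omega> (cont_c_funs \<Omega> UNIV) (cont_c_funs \<Omega> (C i))))"
    (is "?Sel \<and> (finite I \<longrightarrow> ?Fin)")
proof -
  obtain K \<gamma> where "0 < K"
    and dec: "\<And>x. cone_decomposition I C x (K * norm x) (\<lambda>i. \<gamma> i x)"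
    and cont: "\<And>i. i \<in> I \<Longrightarrow> continuous_on UNIV (\<gamma> i)"
    and scale: "\<And>i t x. 0 \<le> t \<Longrightarrow> \<gamma> i (t *\<^sub>R x) = t *\<^sub>R \<gamma> i x"
    by (rule ex_continuous_homogeneous_selection[of I C, OF assms(3,2,4)]) (assumption | rule that)+
  define L where "L f i = (\<lambda>\<omega>\<in>topspace \<Omega>. \<gamma> i (f \<omega>))" for f :: "'a \<Rightarrow> 'x" and i
  have \<gamma>_in: "\<gamma> i x \<in> C i" if "i \<in> I" for i x
    using dec[of x] that by (simp add: cone_decomposition_def)
  have L_cont: "L f i \<in> cont_funs \<Omega> (C i)" if "f \<in> cont_funs \<Omega> UNIV" "i \<in> I" for f i
  proof -
    have "continuous_map \<Omega> euclidean (\<gamma> i \<circ> f)"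
      using that cont by (intro continuous_map_compose[of \<Omega> euclidean]) (auto simp: cont_funs_iff)
    then show ?thesis
      using \<gamma>_in that(2) by (auto simp: L_def cont_funs_iff o_def intro: continuous_map_eq)
  qed
  have L_dom: "dominated_by \<Omega> K f (L f i)" if "i \<in> I" for f i
    using \<open>0 < K\<close> cone_decomposition_norm_le[OF dec that] by (simp add: dominated_by_def L_def)
  have L_dec: "cone_decomposition I C (f \<omega>) (K * norm (f \<omega>)) (\<lambda>i. L f i \<omega>)" if "\<omega> \<in> topspace \<Omega>" for f \<omega>
    using dec[of "f \<omega>"] that by (simp add: L_def)
  have L_hom: "r1 *\<^sub>R L f i \<omega>1 = r2 *\<^sub>R L f i \<omega>2"
    if "\<omega>1 \<in> topspace \<Omega>" "\<omega>2 \<in> topspace \<Omega>" "0 \<le> r1" "0 \<le> r2" "r1 *\<^sub>R f \<omega>1 = r2 *\<^sub>R f \<omega>2"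
    for f i \<omega>1 \<omega>2 r1 r2
    using that by (simp add: L_def scale[symmetric])
  have L_vanish: "vanishes_at_infinity \<Omega> (L f i)"
    if "f \<in> cont_funs \<Omega> UNIV" "i \<in> I" "vanishes_at_infinity \<Omega> f" for f i
  proof -
    have "L f i \<in> cont_funs \<Omega> UNIV"
      using L_cont[OF that(1,2)] by (simp add: cont_funs_iff)
    then show ?thesis
      using solid_class_vanishes_at_infinity[of \<Omega>] that(1,3) L_dom[OF that(2)]
      unfolding solid_class_def by blast
  qed
  have selection: ?Sel
  proof (intro exI[of _ K] conjI ballI)
    fix f :: "'a \<Rightarrow> 'x" assume f: "f \<in> cont_funs \<Omega> UNIV"
    show "\<exists>F. (\<forall>i\<in>I. F i \<in> cont_funs \<Omega> (C i)) \<and>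
            (\<forall>\<omega>\<in>topspace \<Omega>. ((\<lambda>i. F i \<omega>) has_sum f \<omega>) I \<and>
               (\<lambda>i. F i \<omega>) abs_summable_on I \<and>
               (\<Sum>\<^sub>\<infinity>i\<in>I. norm (F i \<omega>)) \<le> K * norm (f \<omega>)) \<and>
            (\<forall>i\<in>I. sup_norm \<Omega> (F i) \<le> ennreal K * sup_norm \<Omega> f) \<and>
            (\<forall>i\<in>I. fun_support \<Omega> (F i) \<subseteq> fun_support \<Omega> f) \<and>
            (vanishes_at_infinity \<Omega> f \<longrightarrow> (\<forall>i\<in>I. vanishes_at_infinity \<Omega> (F i))) \<and>
            (\<forall>\<omega>1\<in>topspace \<Omega>. \<forall>\<omega>2\<in>topspace \<Omega>. \<forall>r1\<ge>0. \<forall>r2\<ge>0.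
               r1 *\<^sub>R f \<omega>1 = r2 *\<^sub>R f \<omega>2 \<longrightarrow> (\<forall>i\<in>I. r1 *\<^sub>R F i \<omega>1 = r2 *\<^sub>R F i \<omega>2))"
    proof (rule exI[of _ "L f"], intro conjI ballI allI impI)
      show "L f i \<in> cont_funs \<Omega> (C i)" if "i \<in> I" for i
        by (rule L_cont[OF f that])
      show "((\<lambda>i. L f i \<omega>) has_sum f \<omega>) I" "(\<lambda>i. L f i \<omega>) abs_summable_on I"
        "(\<Sum>\<^sub>\<infinity>i\<in>I. norm (L f i \<omega>)) \<le> K * norm (f \<omega>)" if "\<omega> \<in> topspace \<Omega>" for \<omega>
        using L_dec[OF that, of f] by (simp_all add: cone_decomposition_def)
      show "sup_norm \<Omega> (L f i) \<le> ennreal K * sup_norm \<Omega> f" if "i \<in> I" for i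
        by (rule sup_norm_dominated[OF L_dom[OF that]])
      show "fun_support \<Omega> (L f i) \<subseteq> fun_support \<Omega> f" if "i \<in> I" for i
        by (rule fun_support_dominated[OF L_dom[OF that]])
      show "vanishes_at_infinity \<Omega> (L f i)" if "vanishes_at_infinity \<Omega> f" "i \<in> I" for i
        by (rule L_vanish[OF f that(2,1)])
    qed (rule L_hom)
  qed fact
  have finite_case: ?Fin if "finite I"
  proof -
    have sum_eq: "x = (\<Sum>i\<in>I. \<gamma> i x)" for x
      using dec[of x] \<open>finite I\<close> by (simp add: cone_decomposition_def has_sum_finite_iff)
    have eq: "{f \<in> cont_funs \<Omega> UNIV. P f} = fun_sum \<Omega> I (\<lambda>i. {f \<in> cont_funs \<Omega> (C i). P f})"
      if "solid_class \<Omega> P" for P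
    proof (rule cont_funs_solid_class_eq_fun_sum[OF \<open>finite I\<close> \<open>I \<noteq> {}\<close> that])
      fix f :: "'a \<Rightarrow> 'x" assume f: "f \<in> cont_funs \<Omega> UNIV"
      have "\<forall>\<omega>\<in>topspace \<Omega>. f \<omega> = (\<Sum>i\<in>I. L f i \<omega>)"
        using sum_eq by (simp add: L_def)
      then show "\<exists>F K. (\<forall>i\<in>I. F i \<in> cont_funs \<Omega> (C i) \<and> dominated_by \<Omega> K f (F i)) \<and>
          (\<forall>\<omega>\<in>topspace \<Omega>. f \<omega> = (\<Sum>i\<in>I. F i \<omega>))"
        using L_cont[OF f] L_dom by blast
    qed
    note classes = solid_class_True[of \<Omega>] solid_class_bounded[of \<Omega>]
      solid_class_vanishes_at_infinity[of \<Omega>] solid_class_compact_support[of \<Omega>]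
    have "(UNIV :: 'x set) = (\<Sum>i\<in>I. C i)"
      using \<gamma>_in sum_eq unfolding set_sum_alt[OF \<open>finite I\<close>] by blast
    moreover note eq[OF classes(1)] eq[OF classes(2)] eq[OF classes(3)] eq[OF classes(4)]
    moreover note fun_cone_solid_class[OF assms(3) classes(1)] fun_cone_solid_class[OF assms(3) classes(2)]
      fun_cone_solid_class[OF assms(3) classes(3)] fun_cone_solid_class[OF assms(3) classes(4)]
    moreover have "closed_in_normed \<Omega> (cont_b_funs \<Omega> UNIV) (cont_b_funs \<Omega> (C i))"
      "closed_in_normed \<Omega> (cont_0_funs \<Omega> UNIV) (cont_0_funs \<Omega> (C i))"
      "closed_in_normed \<Omega> (cont_c_funs \<Omega> UNIV) (cont_c_funs \<Omega> (C i))" if "i \<in> I" for i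
      using cont_0_funs_subset[of \<Omega> "UNIV :: 'x set"] cont_c_funs_subset[of \<Omega> "UNIV :: 'x set"]
      unfolding cont_b_funs_def[of \<Omega> "C i"] cont_0_funs_def[of \<Omega> "C i"] cont_c_funs_def[of \<Omega> "C i"]
      by (auto intro!: closed_in_normed_solid_class[OF assms(2)[OF that]]
          simp: cont_b_funs_def cont_0_funs_def cont_c_funs_def)
    ultimately show ?thesis
      unfolding cont_b_funs_def cont_0_funs_def cont_c_funs_def by simp
  qed
  show ?thesis
    using selection finite_case by blast
qed

end
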